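(* Let $c_0,c_1,c_2,\dots$ be formal (infinitesimal) variables, $P(X)=\sum_{a\ge 0}c_aX^a$, $A(v,y)=v^{-1}P\bigl(v(1+y)^2\bigr)$, and $$T(v,y)\;=\;y+\sum_{r=1}^\infty\frac1{r!}\Bigl(\frac1y\frac{d}{dy}\Bigr)^{r-1}\Bigl(\frac{1+y}{y}\,A(v,y)^r\Bigr)\;\in\;\mathbb{Q}[v^{\pm1},y^{\pm1}][[c_0,c_1,\dots]].$$ Then for every integer $N\ge 1$, $$\bigl[v^{N-1}y^{-2}\bigr]\biggl(\frac{T(v,y)+y}{2}\biggr)^{-N}\;=\;-\,\frac14\,N\binom{2N+2}{N+1}\,c_N .$$
   Context: $[v^{m}y^{k}]F$ denotes the coefficient of $v^my^k$ in $F$, a formal power series in the $c_a$. Since $\frac{T(v,y)+y}{2}=y(1+\varepsilon)$ with $\varepsilon$ in the ideal generated by the $c_a$, its $(-N)$-th power is defined as $y^{-N}(1+\varepsilon)^{-N}$ expanded as a power series in the $c_a$. The operator $\frac1y\frac{d}{dy}$ acts coefficientwise on Laurent polynomials in $y$. *)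

theory Defs
  imports Complex_Main "HOL-Library.Poly_Mapping" "HOL-Library.Product_Plus"
begin

text \<open>Laurent polynomials in v, y over Q: the key (i,j) stands for v^i y^j.\<close>
type_synonym lpoly = "(int \<times> int) \<Rightarrow>\<^sub>0 rat"

text \<open>Monomials in the countably many variables c_0, c_1, ... (exponent vectors).\<close>
type_synonym cmono = "nat \<Rightarrow>\<^sub>0 nat"

text \<open>Formal power series in c_0, c_1, ... with coefficients in Q[v^{+-1}, y^{+-1}].\<close>
type_synonym cser = "cmono \<Rightarrow> lpoly"

definition lmono :: "rat \<Rightarrow> int \<Rightarrow> int \<Rightarrow> lpoly" where
  "lmono a i j = Poly_Mapping.single (i, j) a"

definition ser_const :: "lpoly \<Rightarrow> cser" where
  "ser_const p = (\<lambda>\<mu>. if \<mu> = 0 then p else 0)"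

definition ser_add :: "cser \<Rightarrow> cser \<Rightarrow> cser" where
  "ser_add F G = (\<lambda>\<mu>. F \<mu> + G \<mu>)"

definition ser_diff :: "cser \<Rightarrow> cser \<Rightarrow> cser" where
  "ser_diff F G = (\<lambda>\<mu>. F \<mu> - G \<mu>)"

definition ser_scale :: "rat \<Rightarrow> cser \<Rightarrow> cser" where
  "ser_scale a F = (\<lambda>\<mu>. lmono a 0 0 * F \<mu>)"

text \<open>Cauchy product: the coefficient of c^mu sums over all splittings mu = mu1 + mu2
  (a finite set).\<close>
definition ser_mult :: "cser \<Rightarrow> cser \<Rightarrow> cser" where
  "ser_mult F G = (\<lambda>\<mu>. \<Sum>(\<mu>1, \<mu>2) \<in> {(\<alpha>, \<beta>). \<alpha> + \<beta> = \<mu>}. F \<mu>1 * G \<mu>2)"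

primrec ser_pow :: "cser \<Rightarrow> nat \<Rightarrow> cser" where
  "ser_pow F 0 = ser_const 1"
| "ser_pow F (Suc n) = ser_mult F (ser_pow F n)"

text \<open>Sum of a family of series which is summable in the (c)-adic sense, i.e. for each
  monomial only finitely many members have a nonzero coefficient.\<close>
definition ser_suminf :: "(nat \<Rightarrow> cser) \<Rightarrow> cser" where
  "ser_suminf f = (\<lambda>\<mu>. \<Sum>r \<in> {r. f r \<mu> \<noteq> 0}. f r \<mu>)"

definition cvar :: "nat \<Rightarrow> cser" where
  "cvar a = (\<lambda>\<mu>. if \<mu> = Poly_Mapping.single a 1 then 1 else 0)"

text \<open>The operator (1/y) d/dy on Laurent polynomials: v^i y^j maps to j v^i y^(j-2).\<close>
definition ydiff :: "lpoly \<Rightarrow> lpoly" where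
  "ydiff p = (\<Sum>(i, j) \<in> Poly_Mapping.keys p. lmono (of_int j * Poly_Mapping.lookup p (i, j)) i (j - 2))"

definition ser_ydiff :: "cser \<Rightarrow> cser" where
  "ser_ydiff F = (\<lambda>\<mu>. ydiff (F \<mu>))"

text \<open>A(v,y) = v^{-1} P(v (1+y)^2) = sum_a c_a v^(a-1) (1+y)^(2a).\<close>
definition A_ser :: cser where
  "A_ser = ser_suminf (\<lambda>a. ser_mult (cvar a)
      (ser_const (lmono 1 (int a - 1) 0 * (1 + lmono 1 0 1) ^ (2 * a))))"

definition T_ser :: cser where
  "T_ser = ser_add (ser_const (lmono 1 0 1))
     (ser_suminf (\<lambda>r. if r = 0 then (\<lambda>_. 0) else
        ser_scale (1 / fact r)
          ((ser_ydiff ^^ (r - 1))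
             (ser_mult (ser_const (lmono 1 0 (-1) + 1)) (ser_pow A_ser r)))))"

text \<open>For S = y (1 + eps) with eps in the ideal (c), S^(-N) := y^(-N) (1+eps)^(-N), the latter
  expanded as sum_k binom(-N,k) eps^k.\<close>
definition ser_neg_pow_y :: "cser \<Rightarrow> nat \<Rightarrow> cser" where
  "ser_neg_pow_y S N =
     (let eps = ser_diff (ser_mult (ser_const (lmono 1 0 (-1))) S) (ser_const 1)
      in ser_mult (ser_const (lmono 1 0 (- int N)))
           (ser_suminf (\<lambda>k. ser_scale ((- of_nat N :: rat) gchoose k) (ser_pow eps k))))"

end

theory Submission
  imports Defs "HOL-Computational_Algebra.Formal_Laurent_Series"
begin

unbundle fps_syntax

text \<open>Put \<open>u = y\<^sup>2/2\<close> and \<open>D = d/du\<close>. By Lagrange inversion the map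
  \<open>H \<mapsto> H + \<Sum>\<^sub>r D\<^sup>r\<^sup>-\<^sup>1 (DH A\<^sup>r) / r!\<close> is the ring homomorphism \<open>H(y) \<mapsto> H(Y)\<close>, where
  \<open>Y\<^sup>2/2 = y\<^sup>2/2 + A(Y)\<close>. Hence \<open>T = Y + A(Y)\<close>, and as \<open>y = sqrt (Y\<^sup>2 - 2 A(Y))\<close>, the series
  \<open>((T + y)/2)\<^sup>-\<^sup>N\<close> is the image of \<open>\<Sum>\<^sub>k h\<^sub>k A\<^sup>k\<close>, where \<open>\<Sum>\<^sub>k h\<^sub>k X\<^sup>k = ((y + X + sqrt (y\<^sup>2 - 2X))/2)\<^sup>-\<^sup>N\<close>.
  The functional \<open>[y\<^sup>-\<^sup>2]\<close> annihilates the image of \<open>D\<close>, so in degree \<open>n\<close> in the \<open>c\<^sub>a\<close> only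
  \<open>[y\<^sup>-\<^sup>2] A\<^sup>n (h\<^sub>n + D h\<^sub>n\<^sub>-\<^sub>1 / n)\<close> survives. The coefficient of \<open>v\<^sup>N\<^sup>-\<^sup>1\<close> in \<open>A\<^sup>n\<close> is a multiple of
  \<open>(1 + y)\<^sup>2\<^sup>(\<^sup>N\<^sup>+\<^sup>n\<^sup>-\<^sup>1\<^sup>)\<close>. For \<open>n = 1\<close> this gives the stated binomial coefficient.

  For \<open>n \<ge> 2\<close> the contribution vanishes: with \<open>Z = 1 + y\<close>, \<open>X = Z\<^sup>2 g\<close> and
  \<open>s = (y + X + sqrt (y\<^sup>2 - 2X)) / (2 Z\<^sup>2)\<close>, the series \<open>t = Z (2s - g)/2\<close> satisfies \<open>s = t - t\<^sup>2\<close>, and the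
  contributions are the coefficients of \<open>g\<^sup>n\<^sup>-\<^sup>1\<close>, up to nonzero factors, in the residue in \<open>y\<close> of
  \<open>s\<^sup>-\<^sup>N\<^sup>-\<^sup>1 (ds/dy) / (2s - g)\<close>, which is exact, minus a residue of the form \<open>f(t) dt/dy\<close>, which does
  not depend on \<open>g\<close>.\<close>

section \<open>Lagrange inversion for a derivation\<close>

lemma fps_mult_nth_cong:
  fixes f g h :: "'a::comm_ring_1 fps"
  assumes "\<And>k. k \<le> n \<Longrightarrow> f $ k = g $ k"
  shows "(f * h) $ n = (g * h) $ n"
  by (simp add: fps_mult_nth assms)

text \<open>In the application \<open>D\<close> is (1/y) d/dy on polynomials in the c_a and v^{+-1}
  with Laurent series in y as coefficients. Rational scalars enter through \<open>sc\<close>, so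
  that factorials can be inverted although the ring is not assumed to be a field or a
  domain.\<close>

locale rational_derivation =
  fixes D :: "'a::comm_ring_1 \<Rightarrow> 'a" and sc :: "rat \<Rightarrow> 'a"
  assumes D_add: "D (x + y) = D x + D y"
    and D_mult: "D (x * y) = D x * y + x * D y"
    and D_sc: "D (sc q * x) = sc q * D x"
    and sc_add: "sc (p + q) = sc p + sc q"
    and sc_mult: "sc (p * q) = sc p * sc q"
    and sc_1: "sc 1 = 1"
begin

lemma sc_0: "sc 0 = 0"
  using sc_add[of 0 0] by simp

lemma sc_of_nat: "sc (of_nat n) = of_nat n"
  by (induction n) (auto simp: sc_0 sc_1 sc_add)

lemma D_0: "D 0 = 0"
  using D_add[of 0 0] by simp

lemma D_1: "D 1 = 0"
  using D_mult[of 1 1] by simp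

lemma D_minus: "D (- x) = - D x"
  using D_add[of x "- x"] by (simp add: D_0 minus_unique)

lemma D_sum: "D (sum f I) = (\<Sum>i\<in>I. D (f i))"
  by (induction I rule: infinite_finite_induct) (auto simp: D_0 D_add)

lemma D_power: "D (x ^ n) = of_nat n * x ^ (n - 1) * D x"
proof (induction n)
  case (Suc n)
  then show ?case
    by (cases n) (simp_all add: D_1 D_mult algebra_simps)
qed (simp add: D_1)

lemma D_funpow_add: "(D ^^ n) (x + y) = (D ^^ n) x + (D ^^ n) y"
  by (induction n) (simp_all add: D_add)

lemma sc_inverse_cancel:
  assumes "n > 0" shows "sc (1 / of_nat n) * of_nat n = 1"
  using assms by (simp add: sc_mult[symmetric] sc_of_nat[symmetric] sc_1)

text \<open>Zero divisors are possible, so the factor is removed by multiplying with its inverse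
  \<open>sc (1 / of_nat n)\<close>.\<close>

lemma of_nat_mult_cancel:
  fixes x y :: 'a
  assumes "of_nat n * x = of_nat n * y" "n > 0"
  shows "x = y"
proof -
  have "sc (1 / of_nat n) * of_nat n * x = sc (1 / of_nat n) * of_nat n * y"
    using assms(1) by (simp add: mult.assoc)
  then show ?thesis using assms(2) by (simp add: sc_inverse_cancel)
qed

lemma of_nat_sc_fact: "of_nat (Suc n) * sc (1 / fact (Suc n)) = sc (1 / fact n)"
  by (simp add: sc_of_nat[symmetric] sc_mult[symmetric] del: of_nat_Suc)

definition D_fps :: "'a fps \<Rightarrow> 'a fps" where
  "D_fps f = Abs_fps (\<lambda>n. D (f $ n))"

lemma D_fps_nth [simp]: "D_fps f $ n = D (f $ n)"
  by (simp add: D_fps_def)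

lemma D_fps_mult: "D_fps (f * g) = D_fps f * g + f * D_fps g"
  by (rule fps_ext) (simp add: fps_mult_nth D_sum D_mult sum.distrib)

text \<open>With \<open>u = y\<^sup>2 / 2\<close>, \<open>D = d/du\<close> and \<open>U = u + X A(U)\<close>, Lagrange's theorem says that
  \<open>lagr A H = H(U)\<close> and \<open>lagr_jac A F = F(U) dU/du\<close>.\<close>

definition lagr_jac :: "'a \<Rightarrow> 'a \<Rightarrow> 'a fps" where
  "lagr_jac A F = Abs_fps (\<lambda>r. sc (1 / fact r) * (D ^^ r) (F * A ^ r))"

definition lagr :: "'a \<Rightarrow> 'a \<Rightarrow> 'a fps" where
  "lagr A H = Abs_fps (\<lambda>r. if r = 0 then H else sc (1 / fact r) * (D ^^ (r - 1)) (D H * A ^ r))"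

text \<open>The equation U = u + X A(U) gives dU/dX = A(U) dU/du. This lemma and the next two are
  the corresponding chain rules in X and u, checked here on coefficients.\<close>

lemma deriv_lagr_jac: "fps_deriv (lagr_jac A F) = D_fps (lagr_jac A (F * A))"
proof (rule fps_ext)
  fix n
  have "fps_deriv (lagr_jac A F) $ n
    = (of_nat (Suc n) * sc (1 / fact (Suc n))) * (D ^^ Suc n) (F * A ^ Suc n)"
    by (simp add: lagr_jac_def mult.assoc del: of_nat_Suc fact_Suc)
  also have "\<dots> = D_fps (lagr_jac A (F * A)) $ n"
    unfolding of_nat_sc_fact by (simp add: lagr_jac_def D_sc mult.assoc)
  finally show "fps_deriv (lagr_jac A F) $ n = D_fps (lagr_jac A (F * A)) $ n" .
qed

lemma deriv_lagr: "fps_deriv (lagr A H) = lagr_jac A (D H * A)"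
proof (rule fps_ext)
  fix n
  have "fps_deriv (lagr A H) $ n
    = (of_nat (Suc n) * sc (1 / fact (Suc n))) * (D ^^ n) (D H * A ^ Suc n)"
    by (simp add: lagr_def mult.assoc del: of_nat_Suc fact_Suc)
  also have "\<dots> = lagr_jac A (D H * A) $ n"
    unfolding of_nat_sc_fact by (simp add: lagr_jac_def mult.assoc)
  finally show "fps_deriv (lagr A H) $ n = lagr_jac A (D H * A) $ n" .
qed

lemma D_fps_lagr: "D_fps (lagr A H) = lagr_jac A (D H)"
proof (rule fps_ext)
  show "D_fps (lagr A H) $ n = lagr_jac A (D H) $ n" for n
    by (cases n) (simp_all add: lagr_def lagr_jac_def D_sc sc_1)
qed

text \<open>The constant terms agree, and the X-derivatives agree by the chain rules above.
  Differentiation brings in factors \<open>A\<close>, so the induction on the degree must allow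
  arbitrary \<open>F\<close> and \<open>H\<close>.\<close>

lemma lagr_jac_mult_nth: "lagr_jac A (F * H) $ n = (lagr_jac A F * lagr A H) $ n"
proof (induction n arbitrary: F H rule: less_induct)
  case (less n)
  show ?case
  proof (cases n)
    case 0
    then show ?thesis by (simp add: lagr_jac_def lagr_def sc_1)
  next
    case (Suc m)
    have IH: "lagr_jac A (F * H) $ k = (lagr_jac A F * lagr A H) $ k" if "k \<le> m" for k F H
      using that less Suc by simp
    \<comment> \<open>The factor \<open>A\<close> is moved from one series to the other: up to
      degree \<open>m\<close> both products equal
      \<open>lagr_jac A F * lagr A A * lagr_jac A (D H)\<close> by the induction hypothesis.\<close>
    have "(lagr_jac A F * lagr_jac A (D H * A)) $ m = (lagr_jac A (D H) * lagr A A * lagr_jac A F) $ m"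
      using fps_mult_nth_cong[of m "lagr_jac A (D H * A)" "lagr_jac A (D H) * lagr A A" "lagr_jac A F"] IH
      by (simp only: mult.commute[of "lagr_jac A F"])
    also have "\<dots> = (lagr_jac A F * lagr A A * lagr_jac A (D H)) $ m"
      by (simp add: mult_ac)
    also have "\<dots> = (lagr_jac A (F * A) * lagr_jac A (D H)) $ m"
      using fps_mult_nth_cong[OF IH[symmetric]] by blast
    finally have 1: "(lagr_jac A F * lagr_jac A (D H * A)) $ m
      = (lagr_jac A (F * A) * lagr_jac A (D H)) $ m" .
    have "of_nat (Suc m) * lagr_jac A (F * H) $ Suc m = fps_deriv (lagr_jac A (F * H)) $ m"
      by simp
    also have "\<dots> = D (lagr_jac A (F * A * H) $ m)"
      by (simp add: deriv_lagr_jac mult_ac)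
    also have "\<dots> = D_fps (lagr_jac A (F * A) * lagr A H) $ m"
      using IH[of m "F * A" H] by simp
    also have "\<dots> = fps_deriv (lagr_jac A F * lagr A H) $ m"
      unfolding D_fps_mult fps_deriv_mult deriv_lagr_jac deriv_lagr D_fps_lagr
      using 1 by simp
    also have "\<dots> = of_nat (Suc m) * (lagr_jac A F * lagr A H) $ Suc m"
      unfolding fps_deriv_nth by simp
    finally have "of_nat (Suc m) * lagr_jac A (F * H) $ Suc m
       = of_nat (Suc m) * (lagr_jac A F * lagr A H) $ Suc m" .
    then show ?thesis unfolding Suc by (rule of_nat_mult_cancel) simp
  qed
qed

lemma lagr_jac_mult: "lagr_jac A (F * H) = lagr_jac A F * lagr A H"
  by (rule fps_ext) (rule lagr_jac_mult_nth)

end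

section \<open>Composition and cancellation for power series over a commutative ring\<close>

lemma fps_compose_X_mult:
  fixes e h :: "'a::comm_ring_1 fps"
  assumes "e $ 0 = 0"
  shows "(fps_X * h) oo e = e * (h oo e)"
proof (rule fps_ext)
  fix n
  \<comment> \<open>Because of this vanishing the sums over powers of \<open>e\<close> may be cut
    off or extended at \<open>n\<close> at will.\<close>
  have z: "e ^ k $ m = 0" if "m < k" for k m
    using that assms by (metis startsby_zero_power_prefix)
  have "(e * (h oo e)) $ n = (\<Sum>i=0..n. e $ i * (\<Sum>k=0..n. h $ k * e ^ k $ (n - i)))"
    unfolding fps_mult_nth fps_compose_nth
    by (intro sum.cong refl arg_cong2[of _ _ _ _ "(*)"] sum.mono_neutral_left) (auto simp: z)
  also have "\<dots> = (\<Sum>k=0..n. h $ k * e ^ Suc k $ n)"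
    unfolding sum_distrib_left by (subst sum.swap) (simp add: fps_mult_nth sum_distrib_left mult_ac)
  also have "\<dots> = (\<Sum>k=0..<n. h $ k * e ^ Suc k $ n)"
    by (cases n) (simp_all add: z assms atLeastLessThanSuc_atLeastAtMost sum.atLeast0_atMost_Suc del: power_Suc)
  also have "\<dots> = ((fps_X * h) oo e) $ n"
    by (cases n) (simp_all add: fps_compose_nth sum.atLeast0_atMost_Suc_shift atLeastLessThanSuc_atLeastAtMost
        del: power_Suc sum.cl_ivl_Suc)
  finally show "((fps_X * h) oo e) $ n = (e * (h oo e)) $ n" ..
qed

lemma fps_mult_left_cancel_unit:
  fixes f g :: "'a::comm_ring_1 fps"
  assumes "f * g = 0" and "u * (f $ 0) = 1"
  shows "g = 0"
proof -
  have "g $ n = 0" for n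
  proof (induction n rule: less_induct)
    case (less n)
    have "(f * g) $ n = (\<Sum>i=0..n. f $ i * g $ (n - i))"
      by (simp add: fps_mult_nth)
    also have "\<dots> = (\<Sum>i=0..n. if i = 0 then f $ 0 * g $ n else 0)"
      using less by (intro sum.cong) auto
    also have "\<dots> = f $ 0 * g $ n" by simp
    finally have "u * (f $ 0) * g $ n = 0" using assms(1) by (simp add: mult.assoc)
    then show ?case using assms(2) by simp
  qed
  then show ?thesis by (simp add: fps_eq_iff)
qed

context rational_derivation
begin

text \<open>By \<open>lagr_jac_mult\<close>, both sides agree after multiplication by the Jacobian
  \<open>lagr_jac A 1\<close>, which has constant coefficient 1 and can be cancelled.\<close>

lemma lagr_mult: "lagr A (G * H) = lagr A G * lagr A H"
proof -
  have "lagr_jac A 1 * (lagr A (G * H) - lagr A G * lagr A H) = 0"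
    using lagr_jac_mult[of A 1 "G * H"] lagr_jac_mult[of A G H] lagr_jac_mult[of A 1 G]
    by (simp add: algebra_simps)
  then have "lagr A (G * H) - lagr A G * lagr A H = 0"
    by (rule fps_mult_left_cancel_unit[where u = 1]) (simp add: lagr_jac_def sc_1)
  then show ?thesis by simp
qed

lemma lagr_add: "lagr A (G + H) = lagr A G + lagr A H"
  by (rule fps_ext) (simp add: lagr_def D_add D_funpow_add algebra_simps)

lemma D_funpow_0: "(D ^^ n) 0 = 0"
  by (induction n) (simp_all add: D_0)

lemma lagr_const: "D c = 0 \<Longrightarrow> lagr A c = fps_const c"
  by (rule fps_ext) (simp add: lagr_def D_funpow_0)

lemma D_funpow_sc: "(D ^^ n) (sc q * x) = sc q * (D ^^ n) x"
  by (induction n) (simp_all add: D_sc)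

text \<open>This recovers the defining equation U = u + X A(U).\<close>

lemma lagr_D_eq_1:
  assumes "D u = 1"
  shows "lagr A u = fps_const u + fps_X * lagr A A"
proof (rule fps_ext)
  fix n
  show "lagr A u $ n = (fps_const u + fps_X * lagr A A) $ n"
  proof (cases n)
    case (Suc m)
    show ?thesis
    proof (cases m)
      case 0 then show ?thesis using Suc assms by (simp add: lagr_def sc_1)
    next
      case (Suc l)
      \<comment> \<open>The product \<open>D A * A ^ m\<close> is the derivative of
        \<open>A ^ Suc m / Suc m\<close>; this turns a coefficient of \<open>lagr A A\<close> into
        the next coefficient of \<open>lagr A u\<close>.\<close>
      have "sc (1 / of_nat (Suc m)) * D (A ^ Suc m)
        = (sc (1 / of_nat (Suc m)) * of_nat (Suc m)) * (D A * A ^ m)"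
        by (simp only: D_power diff_Suc_1 mult_ac)
      then have "(D ^^ l) (D A * A ^ m) = (D ^^ l) (sc (1 / of_nat (Suc m)) * D (A ^ Suc m))"
        by (simp only: sc_inverse_cancel zero_less_Suc mult_1)
      also have "\<dots> = sc (1 / of_nat (Suc m)) * (D ^^ m) (A ^ Suc m)"
        using Suc by (simp add: D_funpow_sc funpow_swap1 del: of_nat_Suc power_Suc)
      finally have "sc (1 / fact m) * (D ^^ l) (D A * A ^ m) = sc (1 / fact n) * (D ^^ m) (A ^ Suc m)"
        using \<open>n = Suc m\<close> by (simp add: mult.assoc[symmetric] sc_mult[symmetric] field_simps del: power_Suc)
      then show ?thesis using Suc \<open>n = Suc m\<close> assms by (simp add: lagr_def)
    qed
  qed (simp add: lagr_def)
qed

text \<open>The \<open>X\<close>-linear extension of \<^term>\<open>lagr A\<close>.\<close>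

definition lagr_ext :: "'a \<Rightarrow> 'a fps \<Rightarrow> 'a fps" where
  "lagr_ext A G = Abs_fps (\<lambda>n. \<Sum>k\<le>n. lagr A (G $ k) $ (n - k))"

lemma lagr_0: "lagr A 0 = 0"
  by (simp add: lagr_const D_0)

lemma lagr_ext_add: "lagr_ext A (G + H) = lagr_ext A G + lagr_ext A H"
  by (rule fps_ext) (simp add: lagr_ext_def lagr_add sum.distrib)

lemma lagr_ext_const: "lagr_ext A (fps_const g) = lagr A g"
proof (rule fps_ext)
  fix n
  have "(\<Sum>k\<le>n. lagr A (fps_const g $ k) $ (n - k)) = (\<Sum>k\<le>n. if k = 0 then lagr A g $ n else 0)"
    by (intro sum.cong) (auto simp: lagr_0)
  then show "lagr_ext A (fps_const g) $ n = lagr A g $ n"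
    by (simp add: lagr_ext_def)
qed

lemma lagr_ext_X: "lagr_ext A (fps_X * G) = fps_X * lagr_ext A G"
proof (rule fps_ext)
  fix n
  show "lagr_ext A (fps_X * G) $ n = (fps_X * lagr_ext A G) $ n"
    by (cases n) (simp_all add: lagr_ext_def sum.atMost_Suc_shift lagr_0 del: sum.atMost_Suc)
qed

lemma fps_const_plus_X_mult_exhaust:
  fixes G :: "'a fps"
  obtains g G' where "G = fps_const g + fps_X * G'"
proof
  show "G = fps_const (G $ 0) + fps_X * Abs_fps (\<lambda>n. G $ Suc n)"
  proof (rule fps_ext)
    show "G $ n = (fps_const (G $ 0) + fps_X * Abs_fps (\<lambda>n. G $ Suc n)) $ n" for n
      by (cases n) simp_all
  qed
qed

text \<open>Splitting \<open>H\<close> as a constant plus \<open>fps_X * H'\<close> reduces the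
  degree by one, while the constant part is \<open>lagr_mult\<close>. The next lemma splits the left
  factor in the same way.\<close>

lemma lagr_ext_const_mult_nth: "lagr_ext A (fps_const g * H) $ n = (lagr A g * lagr_ext A H) $ n"
proof (induction n arbitrary: H)
  case 0
  then show ?case by (simp add: lagr_ext_def lagr_def)
next
  case (Suc n)
  obtain h H' where H: "H = fps_const h + fps_X * H'" by (rule fps_const_plus_X_mult_exhaust)
  have "fps_const g * H = fps_const (g * h) + fps_X * (fps_const g * H')"
    by (simp add: H algebra_simps)
  then show ?case
    using Suc by (simp add: H lagr_ext_add lagr_ext_const lagr_ext_X lagr_mult distrib_left
        mult.left_commute[of _ fps_X])
qed

lemma lagr_ext_mult_nth: "lagr_ext A (G * H) $ n = (lagr_ext A G * lagr_ext A H) $ n"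
proof (induction n arbitrary: G)
  case 0
  then show ?case
    using lagr_ext_const_mult_nth[of A "G $ 0" H 0] by (simp add: lagr_ext_def lagr_def)
next
  case (Suc n)
  obtain g G' where G: "G = fps_const g + fps_X * G'" by (rule fps_const_plus_X_mult_exhaust)
  have "G * H = fps_const g * H + fps_X * (G' * H)"
    by (simp add: G algebra_simps)
  then show ?case
    using Suc by (simp add: G lagr_ext_add lagr_ext_const lagr_ext_X lagr_ext_const_mult_nth
        distrib_right mult.assoc)
qed

lemma lagr_ext_mult: "lagr_ext A (G * H) = lagr_ext A G * lagr_ext A H"
  by (rule fps_ext) (rule lagr_ext_mult_nth)

lemma lagr_ext_1: "lagr_ext A 1 = 1"
  using lagr_ext_const[of A 1] by (simp add: lagr_const D_1)

lemma lagr_ext_power: "lagr_ext A (G ^ n) = lagr_ext A G ^ n"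
  by (induction n) (simp_all add: lagr_ext_1 lagr_ext_mult)

lemma lagr_ext_diff: "lagr_ext A (G - H) = lagr_ext A G - lagr_ext A H"
  using lagr_ext_add[of A "G - H" H] by (simp add: algebra_simps)

lemma lagr_ext_0: "lagr_ext A G $ 0 = G $ 0"
  by (simp add: lagr_ext_def lagr_def)

text \<open>Pascal's rule says that the series for \<open>N\<close> is \<open>1 + fps_X\<close>
  times the one for \<open>Suc N\<close>, so each induction step absorbs one factor
  \<open>1 + e\<close>. The lemma identifies the expansion in \<open>ser_neg_pow_y\<close> with a
  genuine inverse power.\<close>

lemma binomial_series_mult:
  assumes "e $ 0 = 0"
  shows "(1 + e) ^ N * (Abs_fps (\<lambda>k. sc ((- of_nat N) gchoose k)) oo e) = 1"
proof (induction N)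
  case 0
  have "Abs_fps (\<lambda>k. sc ((- of_nat 0) gchoose k)) = 1"
    by (rule fps_ext) (simp add: sc_0 sc_1 gbinomial_0_left)
  then show ?case by simp
next
  case (Suc N)
  define g where "g = (\<lambda>N. Abs_fps (\<lambda>k. sc ((- of_nat N) gchoose k)))"
  have "g N = g (Suc N) + fps_X * g (Suc N)"
  proof (rule fps_ext)
    show "g N $ k = (g (Suc N) + fps_X * g (Suc N)) $ k" for k
    proof (cases k)
      case (Suc l)
      have "((- of_nat N) gchoose Suc l :: rat)
          = ((- of_nat (Suc N)) gchoose l) + ((- of_nat (Suc N)) gchoose Suc l)"
        using gbinomial_Suc_Suc[of "- of_nat (Suc N) :: rat" l] by simp
      then show ?thesis by (simp add: Suc g_def sc_add)
    qed (simp add: g_def)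
  qed
  then have "g N oo e = (1 + e) * (g (Suc N) oo e)"
    by (simp add: fps_compose_add_distrib fps_compose_X_mult[OF assms] distrib_right)
  then show ?case using Suc by (simp add: g_def mult_ac)
qed

end

section \<open>A residue that does not depend on the parameter\<close>

text \<open>The coefficients are Laurent series in y and the power series variable X is the
  parameter, so \<open>dy_fps\<close> and \<open>fps_deriv\<close> are the two commuting partial
  derivatives.\<close>

definition dy_fps :: "'a::comm_ring_1 fls fps \<Rightarrow> 'a fls fps" where
  "dy_fps f = Abs_fps (\<lambda>n. fls_deriv (f $ n))"

lemma dy_fps_nth [simp]: "dy_fps f $ n = fls_deriv (f $ n)"
  by (simp add: dy_fps_def)

lemma dy_fps_add: "dy_fps (f + g) = dy_fps f + dy_fps g"
  and dy_fps_diff: "dy_fps (f - g) = dy_fps f - dy_fps g"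
  and dy_fps_const: "dy_fps (fps_const c) = fps_const (fls_deriv c)"
  and dy_fps_X: "dy_fps fps_X = 0"
  and dy_fps_numeral: "dy_fps (numeral k) = 0"
  and dy_fps_1: "dy_fps 1 = 0"
  and dy_fps_deriv: "dy_fps (fps_deriv f) = fps_deriv (dy_fps f)"
  by (rule fps_ext; simp add: fps_X_def fps_numeral_nth fls_deriv_mult
      fls_deriv_of_nat fls_deriv_add)+

lemma dy_fps_mult: "dy_fps (f * g) = dy_fps f * g + f * dy_fps g"
  by (rule fps_ext) (simp add: fps_mult_nth fls_deriv_sum sum.distrib)

lemma dy_fps_inverse:
  fixes f g :: "'a::idom fls fps"
  assumes "f * g = 1"
  shows "dy_fps g = - (g\<^sup>2 * dy_fps f)"
proof -
  have "dy_fps f * g + f * dy_fps g = 0"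
    using arg_cong[OF assms, of dy_fps] by (simp add: dy_fps_mult dy_fps_1)
  then have "g * (dy_fps f * g + f * dy_fps g) = 0" by simp
  moreover have "g * (dy_fps f * g + f * dy_fps g) = g\<^sup>2 * dy_fps f + (f * g) * dy_fps g"
    by algebra
  ultimately show ?thesis using assms by (simp add: add_eq_0_iff)
qed

lemma dy_fps_power: "dy_fps (f ^ n) = of_nat n * f ^ (n - 1) * dy_fps f"
proof (induction n)
  case (Suc n)
  then show ?case
    by (cases n) (simp_all add: dy_fps_1 dy_fps_mult algebra_simps)
qed (simp add: dy_fps_1)

definition res_fps :: "'a::comm_ring_1 fls fps \<Rightarrow> 'a fps" where
  "res_fps f = Abs_fps (\<lambda>n. (f $ n) $$ (- 1))"

lemma res_fps_nth [simp]: "res_fps f $ n = (f $ n) $$ (- 1)"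
  by (simp add: res_fps_def)

lemma res_fps_dy: "res_fps (dy_fps f) = 0"
  by (rule fps_ext) simp

lemma res_fps_add: "res_fps (f + g) = res_fps f + res_fps g"
  and res_fps_diff: "res_fps (f - g) = res_fps f - res_fps g"
  and res_fps_minus: "res_fps (- f) = - res_fps f"
  by (rule fps_ext; simp)+

lemma fls_of_nat_mult_nth: "(of_nat k * f :: 'a::comm_ring_1 fls) $$ n = of_nat k * f $$ n"
  by (induction k) (simp_all add: algebra_simps)

lemma res_fps_of_nat_mult: "res_fps (of_nat k * f) = of_nat k * res_fps f"
  by (induction k) (simp_all add: algebra_simps res_fps_add, rule fps_ext, simp)

lemma res_fps_deriv: "res_fps (fps_deriv f) = fps_deriv (res_fps f)"
proof (rule fps_ext)
  fix n
  have "res_fps (fps_deriv f) $ n = (of_nat (Suc n) * f $ Suc n) $$ (- 1)" by simp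
  also have "\<dots> = fps_deriv (res_fps f) $ n" unfolding fls_of_nat_mult_nth by simp
  finally show "res_fps (fps_deriv f) $ n = fps_deriv (res_fps f) $ n" .
qed

lemma res_fps_X_mult: "res_fps (fps_X * f) = fps_X * res_fps f"
proof (rule fps_ext)
  show "res_fps (fps_X * f) $ n = (fps_X * res_fps f) $ n" for n by (cases n) simp_all
qed

text \<open>Here \<open>r\<close> is 1/(2s - X), and 2r = (1 + X r)/s. The first summand contributes
  s^(-m-1) ds/dy, which is exact because m is positive; the second is X times the same residue for
  \<open>Suc m\<close>. Iterating makes the residue divisible by every power of X.\<close>

lemma res_log_deriv_resolvent:
  fixes s si r :: "'a::field_char_0 fls fps"
  assumes s: "s * si = 1" and r: "(2 * s - fps_X) * r = 1" and m: "m \<ge> 1"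
  shows "res_fps (si ^ m * dy_fps s * r) $ n = 0"
  using m
proof (induction n arbitrary: m)
  have key: "2 * res_fps (si ^ m * dy_fps s * r)
      = fps_X * res_fps (si ^ Suc m * dy_fps s * r)" if "m \<ge> 1" for m
  proof -
    obtain l where l: "m = Suc l" using \<open>m \<ge> 1\<close> by (cases m) auto
    have "dy_fps (si ^ m) = of_nat m * si ^ l * (- (si\<^sup>2 * dy_fps s))"
      by (simp add: dy_fps_power dy_fps_inverse[OF s] l del: of_nat_Suc power_Suc)
    also have "\<dots> = - (of_nat m * (si ^ Suc m * dy_fps s))"
      by (simp add: l algebra_simps power2_eq_square)
    finally have "res_fps (of_nat m * (si ^ Suc m * dy_fps s)) = 0"
      using res_fps_dy[of "si ^ m"] by (simp add: res_fps_minus)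
    then have 0: "res_fps (si ^ Suc m * dy_fps s) = 0"
      using that unfolding res_fps_of_nat_mult by simp
    have "2 * r = si * (1 + fps_X * r)" using s r by algebra
    then have "si ^ m * dy_fps s * (2 * r) = si ^ m * dy_fps s * (si * (1 + fps_X * r))" by simp
    then have "si ^ m * dy_fps s * r + si ^ m * dy_fps s * r
      = si ^ Suc m * dy_fps s + fps_X * (si ^ Suc m * dy_fps s * r)"
      by (simp add: algebra_simps)
    from arg_cong[OF this, of res_fps] show ?thesis
      unfolding res_fps_add 0 res_fps_X_mult mult_2 by simp
  qed
  {
    case (0 m)
    have "res_fps (si ^ m * dy_fps s * r) $ 0 + res_fps (si ^ m * dy_fps s * r) $ 0 = 0"
      using arg_cong[OF key[OF 0], of "\<lambda>f. f $ 0"]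
      unfolding mult_2 fps_add_nth fps_X_mult_nth by (simp del: res_fps_nth power_Suc)
    then show ?case unfolding mult_2[symmetric] by (simp del: res_fps_nth)
  next
    case (Suc n m)
    have "res_fps (si ^ m * dy_fps s * r) $ Suc n + res_fps (si ^ m * dy_fps s * r) $ Suc n = 0"
      using arg_cong[OF key[OF Suc.prems], of "\<lambda>f. f $ Suc n"] Suc.IH[of "Suc m"]
      unfolding mult_2 fps_add_nth fps_X_mult_nth by (simp del: res_fps_nth power_Suc)
    then show ?case unfolding mult_2[symmetric] by (simp del: res_fps_nth)
  }
qed

text \<open>This holds for every rational function \<open>f\<close> of \<open>t\<close>, and it makes the \<open>X\<close>-derivative of
  \<open>f dt/dy\<close> equal to the \<open>y\<close>-derivative of \<open>f dt/dX\<close>.\<close>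

definition dependent_on :: "'a::comm_ring_1 fls fps \<Rightarrow> 'a fls fps \<Rightarrow> bool" where
  "dependent_on t f \<longleftrightarrow> (\<exists>d. fps_deriv f = d * fps_deriv t \<and> dy_fps f = d * dy_fps t)"

lemma dependent_on_self: "dependent_on t t"
  unfolding dependent_on_def by (rule exI[of _ 1]) simp

lemma dependent_on_1: "dependent_on t 1"
  and dependent_on_numeral: "dependent_on t (numeral k)"
  unfolding dependent_on_def by (rule exI[of _ 0]; simp add: dy_fps_1 dy_fps_numeral)+

lemma dependent_on_add: "dependent_on t f \<Longrightarrow> dependent_on t g \<Longrightarrow> dependent_on t (f + g)"
  unfolding dependent_on_def fps_deriv_add dy_fps_add by (metis distrib_right)

lemma dependent_on_diff: "dependent_on t f \<Longrightarrow> dependent_on t g \<Longrightarrow> dependent_on t (f - g)"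
  unfolding dependent_on_def fps_deriv_sub dy_fps_diff by (metis left_diff_distrib)

lemma dependent_on_mult:
  assumes "dependent_on t f" "dependent_on t g"
  shows "dependent_on t (f * g)"
proof -
  obtain d e where "fps_deriv f = d * fps_deriv t" "dy_fps f = d * dy_fps t"
    "fps_deriv g = e * fps_deriv t" "dy_fps g = e * dy_fps t"
    using assms unfolding dependent_on_def by blast
  then show ?thesis unfolding dependent_on_def
    by (intro exI[of _ "f * e + d * g"]) (simp add: dy_fps_mult algebra_simps)
qed

lemma dependent_on_power: "dependent_on t f \<Longrightarrow> dependent_on t (f ^ n)"
  by (induction n) (simp_all add: dependent_on_1 dependent_on_mult)

lemma dependent_on_inverse:
  fixes f g :: "'a::idom fls fps"
  assumes "dependent_on t f" "f * g = 1"
  shows "dependent_on t g"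
proof -
  obtain d where d: "fps_deriv f = d * fps_deriv t" "dy_fps f = d * dy_fps t"
    using assms unfolding dependent_on_def by blast
  have "f * fps_deriv g + fps_deriv f * g = 0"
    using arg_cong[OF assms(2), of fps_deriv] by simp
  then have "fps_deriv g = - (g\<^sup>2 * fps_deriv f)" using assms(2) by algebra
  then show ?thesis unfolding dependent_on_def
    by (intro exI[of _ "- (g\<^sup>2 * d)"]) (simp add: d dy_fps_inverse[OF assms(2)])
qed

text \<open>The X-derivative of this residue is the residue of a y-derivative, hence zero; in
  characteristic zero only the constant term can survive.\<close>

lemma res_dependent:
  fixes f t :: "'a::field_char_0 fls fps"
  assumes "dependent_on t f"
  shows "res_fps (f * dy_fps t) $ Suc n = 0"
proof -
  obtain d where d: "fps_deriv f = d * fps_deriv t" "dy_fps f = d * dy_fps t"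
    using assms unfolding dependent_on_def by blast
  have "fps_deriv (f * dy_fps t) = dy_fps (f * fps_deriv t)"
    by (simp add: dy_fps_mult dy_fps_deriv d algebra_simps)
  then have "fps_deriv (res_fps (f * dy_fps t)) = 0"
    by (simp add: res_fps_deriv[symmetric] res_fps_dy)
  then have "fps_deriv (res_fps (f * dy_fps t)) $ n = 0" by simp
  then show ?thesis unfolding fps_deriv_nth by (simp del: of_nat_Suc)
qed

lemma one_plus_fls_X_nonzero: "(1 + fls_X :: 'a::comm_ring_1 fls) \<noteq> 0"
proof
  assume "(1 + fls_X :: 'a fls) = 0"
  then have "(1 + fls_X :: 'a fls) $$ 0 = 0" by simp
  then show False by simp
qed

text \<open>Here \<open>s1, t1\<close> and \<open>s2, t2\<close> stand for the derivatives of \<open>s, t\<close> with respect to \<open>g\<close> and \<open>y\<close>,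
  where \<open>Z = 1 + y\<close>.\<close>

lemma exactness_identity:
  fixes Z t s g s1 t1 s2 t2 J :: "'a::idom"
  assumes t: "2 * t = Z * (2 * s - g)" and s: "s = t - t\<^sup>2"
    and t1: "2 * t1 = Z * (2 * s1 - 1)" and s1: "s1 = (1 - 2 * t) * t1"
    and t2: "2 * t2 = (2 * s - g) + 2 * Z * s2" and s2: "s2 = (1 - 2 * t) * t2"
    and J: "Z\<^sup>2 * J = (2 * g * Z - (Z - 1)) * s1 - 2 * Z * s"
    and nz: "t \<noteq> 0" "Z \<noteq> 0" "(2::'a) \<noteq> 0"
  shows "2 * t * J = (Z - 1) * s2 - 4 * t\<^sup>2 * t2"
proof -
  \<comment> \<open>After \<open>s1\<close> and \<open>s2\<close> are eliminated, \<open>d\<close>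
    is, up to the factor 2, the coefficient of both \<open>t1\<close> and \<open>t2\<close>. It is
    nonzero since \<open>Z * t2 * d = t\<close>, and so can be cancelled at the end.\<close>
  define d where "d = 1 - Z * (1 - 2 * t)"
  have d1: "2 * (t1 * d) = - Z" using t1 s1 unfolding d_def by algebra
  have "2 * (Z * t2 * d) = 2 * t" using t2 s2 t unfolding d_def by algebra
  then have d2: "Z * t2 * d = t" using nz(3) by simp
  have "d \<noteq> 0" using d2 nz(1) by auto
  have "2 * t * (Z\<^sup>2 * J) * d = t * ((2 * g * Z - (Z - 1)) * (1 - 2 * t) * (2 * (t1 * d))) - 4 * t * Z * s * d"
    unfolding J s1 by algebra
  also have "\<dots> = - t * Z * ((2 * (g * Z) - (Z - 1)) * (1 - 2 * t) + 4 * s * d)"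
    unfolding d1 by algebra
  also have "\<dots> = t * Z * ((Z - 1) * (1 - 2 * t) - 4 * t\<^sup>2)"
  proof -
    have "g * Z = 2 * s * Z - 2 * t" using t by algebra
    then show ?thesis using s unfolding d_def by algebra
  qed
  also have "\<dots> = Z * ((Z - 1) * (1 - 2 * t) - 4 * t\<^sup>2) * (Z * t2 * d)"
    unfolding d2 by algebra
  also have "\<dots> = Z\<^sup>2 * d * ((Z - 1) * s2 - 4 * t\<^sup>2 * t2)"
    unfolding s2 by algebra
  finally have "(Z\<^sup>2 * d) * (2 * t * J) = (Z\<^sup>2 * d) * ((Z - 1) * s2 - 4 * t\<^sup>2 * t2)"
    by (simp add: mult_ac)
  then show ?thesis using nz \<open>d \<noteq> 0\<close> by simp
qed

text \<open>Dividing the exactness identity by \<open>2 * t\<close> splits s^(-N-1) J into s^(-N-1)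
  (ds/dy)/(2s - X), whose residue vanishes, and a function of \<open>t\<close> times dt/dy, whose
  residue is constant in X. No positive power of X remains.\<close>

lemma residue_identity:
  fixes s t si J Z :: "'a::field_char_0 fls fps"
  defines "Z \<equiv> fps_const (1 + fls_X)"
  assumes t: "2 * t = Z * (2 * s - fps_X)" and s: "s = t - t\<^sup>2"
    and J: "Z\<^sup>2 * J = (2 * fps_X * Z - (Z - 1)) * fps_deriv s - 2 * Z * s"
    and si: "s * si = 1" and t0: "t $ 0 \<noteq> 0"
  shows "res_fps (si ^ Suc N * J) $ Suc n = 0"
proof -
  have dZ: "fps_deriv Z = 0" "dy_fps Z = 1"
    by (simp_all add: Z_def dy_fps_const)
  have nz: "t \<noteq> 0" "Z \<noteq> 0" using t0 by (auto simp: Z_def one_plus_fls_X_nonzero)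
  have 2: "2 * t * J = (Z - 1) * dy_fps s - 4 * t\<^sup>2 * dy_fps t"
  proof (rule exactness_identity[OF t s _ _ _ _ J nz])
    show "2 * fps_deriv t = Z * (2 * fps_deriv s - 1)"
      using arg_cong[OF t, of fps_deriv] by (simp add: dZ)
    show "fps_deriv s = (1 - 2 * t) * fps_deriv t"
      unfolding s by (simp add: power2_eq_square algebra_simps)
    show "2 * dy_fps t = (2 * s - fps_X) + 2 * Z * dy_fps s"
      using arg_cong[OF t, of dy_fps]
      by (simp add: dZ dy_fps_mult dy_fps_diff dy_fps_numeral dy_fps_X)
    show "dy_fps s = (1 - 2 * t) * dy_fps t"
      unfolding s by (simp add: power2_eq_square dy_fps_mult dy_fps_diff algebra_simps)
  qed simp
  define it where "it = inverse (2 * t)"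
  have it: "2 * t * it = 1" unfolding it_def using t0
    by (intro inverse_mult_eq_1') simp
  define r where "r = Z * it"
  have r: "(2 * s - fps_X) * r = 1" unfolding r_def using t it by algebra
  define f where "f = si ^ Suc N * ((1 - 2 * t) * it + 2 * t)"
  have dep: "dependent_on t f" unfolding f_def
    by (intro dependent_on_mult dependent_on_add dependent_on_power dependent_on_diff
        dependent_on_1 dependent_on_self dependent_on_numeral
        dependent_on_inverse[OF _ it] dependent_on_inverse[OF _ si])
      (auto simp: s intro!: dependent_on_mult dependent_on_power dependent_on_diff
        dependent_on_self dependent_on_numeral)
  have sy: "dy_fps s = (1 - 2 * t) * dy_fps t"
    unfolding s by (simp add: power2_eq_square dy_fps_mult dy_fps_diff algebra_simps)
  \<comment> \<open>In (Z - 1)/(2t) the summand Z/(2t) is \<open>r\<close>; the summand -1/(2t)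
    joins the dt/dy part through ds/dy = (1 - 2t) dt/dy.\<close>
  have J_eq: "J = dy_fps s * r - ((1 - 2 * t) * it + 2 * t) * dy_fps t"
    using 2 it sy unfolding r_def by algebra
  have "si ^ Suc N * J = si ^ Suc N * dy_fps s * r - f * dy_fps t"
    unfolding J_eq f_def by (simp only: right_diff_distrib mult.assoc)
  then show ?thesis
    using res_log_deriv_resolvent[OF si r, of "Suc N" "Suc n"] res_dependent[OF dep, of n]
    by (simp add: res_fps_diff)
qed

section \<open>Powers of the solution of a quadratic equation\<close>

lemma fls_X_mult_X_inv: "fls_X * fls_X_inv = (1 :: 'a::comm_ring_1 fls)"
  by (simp add: fls_X_times_conv_shift)

lemma fls_const_half: "2 * fls_const (1 / 2) = (1 :: 'a::field_char_0 fls)"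
proof -
  have "fls_const 2 * fls_const (1 / 2) = (fls_const 1 :: 'a fls)"
    unfolding fls_const_mult_const by simp
  then show ?thesis by simp
qed

lemma fps_const_half: "2 * fps_const (1 / 2) = (1 :: 'a::field_char_0 fps)"
  unfolding numeral_fps_const fps_const_mult by simp

text \<open>The function passed to \<open>fps_radical\<close> selects the root y of the constant
  coefficient y^2 and thereby fixes the branch.\<close>

definition sqrt_ser :: "'a::field_char_0 fls fps" where
  "sqrt_ser = fps_radical (\<lambda>_ _. fls_X) 2 (fps_const (fls_X\<^sup>2) - 2 * fps_X)"

lemma sqrt_ser_power2: "sqrt_ser\<^sup>2 = fps_const (fls_X\<^sup>2 :: 'a::field_char_0 fls) - 2 * fps_X"
proof -
  have "(fps_radical (\<lambda>_ _. fls_X) (Suc 1) (fps_const (fls_X\<^sup>2 :: 'a fls) - 2 * fps_X)) ^ Suc 1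
     = fps_const (fls_X\<^sup>2 :: 'a fls) - 2 * fps_X"
    by (rule power_radical[THEN iffD1]) (simp_all add: power2_eq_square)
  then show ?thesis by (simp add: sqrt_ser_def numeral_2_eq_2)
qed

lemma sqrt_ser_0: "sqrt_ser $ 0 = fls_X"
  by (simp add: sqrt_ser_def)

lemma sqrt_ser_1: "sqrt_ser $ 1 = - (fls_X_inv :: 'a::field_char_0 fls)"
proof -
  have "(sqrt_ser\<^sup>2 :: 'a fls fps) $ 1 = - 2"
    unfolding sqrt_ser_power2 by simp
  moreover have "(sqrt_ser\<^sup>2 :: 'a fls fps) $ 1 = fls_X * sqrt_ser $ 1 + sqrt_ser $ 1 * fls_X"
    by (simp add: power2_eq_square fps_mult_nth sqrt_ser_0)
  ultimately show ?thesis
    using fls_X_mult_X_inv[where 'a = 'a] fls_const_half[where 'a = 'a] by algebra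
qed

definition half_sum_ser :: "'a::field_char_0 fls fps" where
  "half_sum_ser = fps_const (1 / 2) * (fps_const fls_X + fps_X + sqrt_ser)"

lemma half_sum_ser_eq: "2 * half_sum_ser = fps_const fls_X + fps_X + (sqrt_ser :: 'a::field_char_0 fls fps)"
  unfolding half_sum_ser_def using fps_const_half[where 'a = "'a fls"] by algebra

lemma half_sum_ser_0: "half_sum_ser $ 0 = fls_X"
  by (simp add: half_sum_ser_def sqrt_ser_0)

lemma half_sum_ser_1: "half_sum_ser $ 1 = fls_const (1 / 2) * (1 - fls_X_inv :: 'a::field_char_0 fls)"
proof -
  have "(half_sum_ser + half_sum_ser) $ 1 = (1 - fls_X_inv :: 'a fls)"
    unfolding mult_2[symmetric] half_sum_ser_eq by (simp add: sqrt_ser_1[simplified])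
  then have "half_sum_ser $ 1 + half_sum_ser $ 1 = (1 - fls_X_inv :: 'a fls)"
    by (simp only: fps_add_nth)
  then show ?thesis using fls_const_half[where 'a = 'a] by algebra
qed

definition inv_pow_ser :: "nat \<Rightarrow> 'a::field_char_0 fls fps" where
  "inv_pow_ser N = inverse (half_sum_ser ^ N)"

lemma inv_pow_ser_mult: "inv_pow_ser N * half_sum_ser ^ N = 1"
  unfolding inv_pow_ser_def
  by (rule inverse_mult_eq_1) (simp add: half_sum_ser_0)

lemma inv_pow_ser_0: "inv_pow_ser N $ 0 = fls_X_inv ^ N"
  by (simp add: inv_pow_ser_def fps_power_zeroth half_sum_ser_0 power_inverse[symmetric] fls_inverse_X)

lemma inv_pow_ser_1:
  "inv_pow_ser N $ 1 = - (of_nat N * fls_const (1 / 2) * (1 - fls_X_inv) * fls_X_inv ^ Suc N :: 'a::field_char_0 fls)"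
proof (cases N)
  case 0
  then show ?thesis by (simp add: inv_pow_ser_def)
next
  case (Suc k)
  have X: "fls_X * fls_X_inv = (1 :: 'a fls)" by (rule fls_X_mult_X_inv)
  have Xn: "fls_X ^ n * fls_X_inv ^ n = (1 :: 'a fls)" for n
    by (simp add: power_mult_distrib[symmetric] X)
  \<comment> \<open>The linear coefficient is found by differentiating the relation
    \<open>inv_pow_ser_mult\<close> at X = 0.\<close>
  have "fps_deriv (inv_pow_ser N * half_sum_ser ^ N) $ 0 = (0 :: 'a fls)"
    unfolding inv_pow_ser_mult by simp
  then have "inv_pow_ser N $ 1 * fls_X ^ N
      + fls_X_inv ^ N * (of_nat N * (fls_const (1/2) * (1 - fls_X_inv) * fls_X ^ k)) = (0 :: 'a fls)"
    using half_sum_ser_1[where 'a = 'a]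
    by (simp add: fps_deriv_power fps_power_zeroth inv_pow_ser_0 half_sum_ser_0 Suc mult_ac add_ac
        of_nat_1[unfolded One_nat_def] del: of_nat_Suc power_Suc)
  then have "(inv_pow_ser N $ 1 * fls_X ^ N
      + fls_X_inv ^ N * (of_nat N * (fls_const (1/2) * (1 - fls_X_inv) * fls_X ^ k))) * fls_X_inv ^ N = (0 :: 'a fls)"
    by simp
  then have "inv_pow_ser N $ 1 * (fls_X ^ N * fls_X_inv ^ N)
      + fls_X_inv ^ N * (of_nat N * (fls_const (1/2) * (1 - fls_X_inv) * (fls_X ^ k * fls_X_inv ^ k) * fls_X_inv)) = (0 :: 'a fls)"
    by (simp add: Suc algebra_simps)
  then show ?thesis unfolding Xn by (simp add: add_eq_0_iff2 mult_ac)
qed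

text \<open>The two summands combine to -(N/2) y^(-N-2) (1 + y), which raises the exponent of 1 + y
  to 2N + 1. What is left is the binomial coefficient of 2N + 1 over N, half of the one
  claimed.\<close>

lemma coefficient_first_order:
  "((1 + fls_X) ^ (2 * N) * (inv_pow_ser N $ 1 + fls_X_inv * fls_deriv (inv_pow_ser N $ 0))) $$ (- 2)
    = - (1 / 4) * of_nat N * of_nat ((2 * N + 2) choose (N + 1) :: nat) "
  (is "?lhs = (?rhs :: 'a::field_char_0)")
proof -
  have X: "fls_X * fls_X_inv = (1 :: 'a fls)" by (rule fls_X_mult_X_inv)
  have "(1 + fls_X) ^ (2 * N) * (inv_pow_ser N $ 1 + fls_X_inv * fls_deriv (inv_pow_ser N $ 0))
     = (1 + fls_X) ^ (2 * N) * (- (of_nat N * (fls_const (1 / 2) * (1 + fls_X_inv) * fls_X_inv ^ Suc N)) :: 'a fls)"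
  proof -
    have "- (k * c * (1 - x) * b) + x * (- k * b) = - (k * (c * (1 + x) * b))"
      if "2 * c = 1" for k c x b :: "'a fls"
      using that by algebra
    from this[OF fls_const_half] show ?thesis
      unfolding inv_pow_ser_0 inv_pow_ser_1 fls_deriv_X_inv_power by simp
  qed
  also have "\<dots> = - (of_nat N * fls_const (1 / 2)) * (fls_X_inv ^ (N + 2) * (1 + fls_X) ^ (2 * N + 1))"
  proof -
    have "z * - (k * (c * (1 + xi) * (xi * b))) = - (k * c) * ((b * (xi * xi)) * (z * (1 + x)))"
      if "x * xi = 1" for z k c x xi b :: "'a fls"
      using that by algebra
    from this[OF X] show ?thesis
      unfolding power_add power_one_right power_Suc power2_eq_square .
  qed
  also have "(1 + fls_X) ^ (2 * N + 1) = fps_to_fls (fps_binomial (of_nat (2 * N + 1)) :: 'a fps)"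
    unfolding fps_binomial_of_nat fps_to_fls_power fps_to_fls_plus fps_one_to_fls fps_X_to_fls ..
  also have "- (of_nat N * fls_const (1 / 2)) = fls_const (- (of_nat N / 2) :: 'a)"
    by (simp add: fls_of_nat)
  finally have "?lhs = (fls_const (- (of_nat N / 2) :: 'a)
      * (fls_X_inv ^ (N + 2) * fps_to_fls (fps_binomial (of_nat (2 * N + 1))))) $$ (- 2)"
    by (rule arg_cong)
  also have "\<dots> = - (of_nat N / 2)
      * ((fls_X_inv ^ (N + 2) * fps_to_fls (fps_binomial (of_nat (2 * N + 1)))) $$ (- 2))"
    by (simp only: fls_mult_const_nth)
  also have "(fls_X_inv ^ (N + 2) * fps_to_fls (fps_binomial (of_nat (2 * N + 1)))) $$ (- 2)
      = (of_nat (2 * N + 1) gchoose N :: 'a)"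
    unfolding fls_X_inv_power_times_conv_shift by simp
  also have "(of_nat (2 * N + 1) gchoose N :: 'a) = of_nat ((2 * N + 1) choose N)"
    by (rule binomial_gbinomial[symmetric])
  also have "\<dots> = of_nat ((2 * N + 2) choose (N + 1)) / 2"
  proof -
    have "(2 * N + 2) choose (N + 1) = 2 * ((2 * N + 1) choose N)"
      using binomial_symmetric[of N "2 * N + 1"] by simp
    then show ?thesis by simp
  qed
  finally show ?thesis by simp
qed

lemma fps_compose_linear_power:
  fixes f :: "'a::idom fps"
  shows "(f ^ n) oo (fps_const c * fps_X) = (f oo (fps_const c * fps_X)) ^ n"
  by (rule fps_compose_power[symmetric]) simp

lemma coefficient_higher_order:
  fixes N n :: nat
  assumes "n \<ge> 2" "N \<ge> 1"
  shows "((1 + fls_X) ^ (2 * (N + n - 1)) * (inv_pow_ser N $ n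
      + fls_const (1 / of_nat n) * (fls_X_inv * fls_deriv (inv_pow_ser N $ (n - 1))))) $$ (- 2)
    = (0 :: 'a::field_char_0)"
proof -
  define z :: "'a fls" where "z = 1 + fls_X"
  have z: "z \<noteq> 0" using one_plus_fls_X_nonzero by (simp add: z_def)
  define Z where "Z = fps_const z"
  \<comment> \<open>Replacing X by (1 + y)^2 X attaches the power of 1 + y to each coefficient, so
    that all degrees are treated by one generating series; \<open>H\<close> below has the
    coefficients \<open>Hn\<close>.\<close>
  define L where "L = (\<lambda>f :: 'a fls fps. f oo (fps_const (z\<^sup>2) * fps_X))"
  have L_mult: "L (f * g) = L f * L g" for f g
    unfolding L_def by (rule fps_compose_mult_distrib) simp
  have L_add: "L (f + g) = L f + L g" and L_diff: "L (f - g) = L f - L g" for f g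
    unfolding L_def by (rule fps_compose_add_distrib fps_compose_sub_distrib)+
  have L_nth: "L f $ n = (z\<^sup>2) ^ n * f $ n" for f n
    unfolding L_def fps_compose_linear by simp
  have L_power: "L (f ^ k) = L f ^ k" for f k
    unfolding L_def by (rule fps_compose_linear_power)
  have L_const: "L (fps_const c) = fps_const c" for c unfolding L_def by simp
  have L_X: "L fps_X = Z\<^sup>2 * fps_X" unfolding L_def Z_def by simp
  have L_2: "L 2 = 2" using L_const[of 2] by (simp add: numeral_fps_const)
  define iz where "iz = fps_const (inverse z)"
  have iz: "Z * iz = 1" unfolding Z_def iz_def using z by simp
  \<comment> \<open>After rescaling \<open>X\<close> and \<open>half_sum_ser\<close> by \<open>(1 + y)\<^sup>2\<close>, the quadratic equation of
    \<open>half_sum_ser\<close> becomes \<open>s = t - t\<^sup>2\<close>.\<close>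
  define s where "s = iz\<^sup>2 * L half_sum_ser"
  define t where "t = fps_const (1 / 2) * (Z * (2 * s - fps_X))"
  have t2: "2 * t = Z * (2 * s - fps_X)"
    unfolding t_def using fps_const_half[where 'a = "'a fls"] by algebra
  define w where "w = L sqrt_ser"
  define y :: "'a fls fps" where "y = fps_const fls_X"
  have Zy: "Z = 1 + y" unfolding Z_def z_def y_def by (simp add: fps_const_add[symmetric] del: fps_const_add)
  have w2: "w\<^sup>2 = y\<^sup>2 - 2 * (Z\<^sup>2 * fps_X)"
    using arg_cong[OF sqrt_ser_power2, of L]
    by (simp add: w_def y_def L_power L_diff L_mult L_const L_X L_2)
  have "L (2 * half_sum_ser) = y + Z\<^sup>2 * fps_X + w"
    unfolding half_sum_ser_eq by (simp add: w_def y_def L_add L_const L_X)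
  then have s2: "2 * Z\<^sup>2 * s = y + Z\<^sup>2 * fps_X + w"
    using iz unfolding s_def L_mult L_2 by algebra
  have "4 * Z\<^sup>2 * (t\<^sup>2 - t + s) = 0"
    using t2 s2 w2 Zy by algebra
  moreover have "4 * Z\<^sup>2 \<noteq> 0" using z by (simp add: Z_def)
  ultimately have "t\<^sup>2 - t + s = 0" by (simp only: mult_eq_0_iff) simp
  then have st: "s = t - t\<^sup>2" by algebra
  have s0: "s $ 0 = fls_X * (inverse z)\<^sup>2"
    by (simp add: s_def L_nth half_sum_ser_0 iz_def)
  have "t $ 0 = z * s $ 0" by (simp add: t_def Z_def)
  then have t0: "t $ 0 \<noteq> 0" using z by (simp add: s0)
  define si where "si = inverse s"
  have si: "s * si = 1" unfolding si_def using z
    by (intro inverse_mult_eq_1') (simp add: s0)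
  define H where "H = si ^ N"
  have "L (inv_pow_ser N) * (Z\<^sup>2 * s) ^ N = 1"
  proof -
    have "Z\<^sup>2 * s = L half_sum_ser" unfolding s_def using iz by algebra
    then show ?thesis
      using arg_cong[OF inv_pow_ser_mult[of N], of L] L_const[of 1] by (simp add: L_mult L_power)
  qed
  then have "(L (inv_pow_ser N) * ((Z\<^sup>2) ^ N * s ^ N)) * si ^ N = H"
    unfolding H_def power_mult_distrib[symmetric] by simp
  then have "L (inv_pow_ser N) * (Z\<^sup>2) ^ N * (s ^ N * si ^ N) = H"
    by (simp only: mult_ac)
  then have HL: "H = L (inv_pow_ser N) * (Z\<^sup>2) ^ N"
    by (simp add: power_mult_distrib[symmetric] si)
  have Hn: "H $ k = z ^ (2 * (N + k)) * inv_pow_ser N $ k" for k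
    unfolding HL Z_def fps_const_power fps_mult_right_const_nth L_nth
    by (simp add: power_add power_mult power2_eq_square power_mult_distrib mult_ac)
  define J where "J = iz\<^sup>2 * ((2 * fps_X * Z - (Z - 1)) * fps_deriv s - 2 * Z * s)"
  have J: "Z\<^sup>2 * J = (2 * fps_X * Z - (Z - 1)) * fps_deriv s - 2 * Z * s"
    using iz unfolding J_def by algebra
  obtain m where m: "n = Suc (Suc m)" using assms(1) by (metis add_2_eq_Suc le_Suc_ex)
  have "res_fps (si ^ Suc N * J) $ Suc m = 0"
    by (rule residue_identity[OF _ st _ si t0]) (use t2 J in \<open>simp_all add: Z_def z_def\<close>)
  \<comment> \<open>This links the residue identity to \<open>H\<close> = s^(-N), by the derivative
    -N s^(-N-1) ds/dX of \<open>H\<close>. Its coefficient in degree \<open>Suc m\<close>, that is n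
    - 1, involves exactly \<open>H $ n\<close> and \<open>H $ Suc m\<close>.\<close>
  moreover have "of_nat N * (si ^ Suc N * J) =
      iz\<^sup>2 * (y * fps_deriv H) - 2 * iz * (fps_X * fps_deriv H + of_nat N * H)"
  proof -
    have "s * fps_deriv si + fps_deriv s * si = 0"
      using arg_cong[OF si, of fps_deriv] by simp
    then have dsi: "fps_deriv si = - (si\<^sup>2 * fps_deriv s)" using si by algebra
    obtain l where l: "N = Suc l" using assms(2) by (cases N) auto
    have dH: "fps_deriv H = - (of_nat N * (si ^ Suc N * fps_deriv s))"
      unfolding H_def fps_deriv_power dsi by (simp add: l fps_of_nat power2_eq_square mult_ac del: of_nat_Suc)
    have "H = si ^ Suc N * s" unfolding H_def using si by (simp add: mult_ac)
    moreover have "k * (p * (iz\<^sup>2 * ((2 * x * (1 + y) - (1 + y - 1)) * d - 2 * (1 + y) * s)))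
        = iz\<^sup>2 * (y * - (k * (p * d))) - 2 * iz * (x * - (k * (p * d)) + k * h)"
      if "h = p * s" for k p x d h :: "'a fls fps"
      using that iz[unfolded Zy] by algebra
    ultimately show ?thesis unfolding J_def dH Zy by blast
  qed
  ultimately have 0: "res_fps (iz\<^sup>2 * (y * fps_deriv H) - 2 * iz * (fps_X * fps_deriv H + of_nat N * H)) $ Suc m = 0"
    by (metis mult_zero_right res_fps_of_nat_mult fps_of_nat fps_mult_left_const_nth)
  have XH: "(fps_X * fps_deriv H + of_nat N * H) $ Suc m = of_nat (N + Suc m) * H $ Suc m"
    by (simp add: fps_of_nat[symmetric] algebra_simps del: fps_of_nat)
  have iz2: "iz\<^sup>2 = fps_const ((inverse z)\<^sup>2)" "2 * iz = fps_const (2 * inverse z)"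
    by (simp_all add: iz_def numeral_fps_const)
  have 1: "((inverse z)\<^sup>2 * (fls_X * (of_nat n * H $ n))
      - 2 * inverse z * (of_nat (N + Suc m) * H $ Suc m)) $$ (- 1) = 0"
    using 0 unfolding iz2 y_def res_fps_nth fps_sub_nth fps_mult_left_const_nth XH fps_deriv_nth m
    by simp
  define h where "h = (inv_pow_ser N :: 'a fls fps)"
  define p where "p = 2 * (N + Suc m)"
  have dz: "fls_deriv z = 1" by (simp add: z_def)
  have izz: "inverse z * z = 1" using z by simp
  have Hn': "H $ n = z ^ p * z\<^sup>2 * h $ n"
  proof -
    have "2 * (N + n) = p + 2" by (simp add: p_def m)
    then show ?thesis by (simp only: Hn h_def power_add)
  qed
  have Hm: "H $ Suc m = z ^ p * h $ Suc m"
    unfolding Hn h_def p_def ..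
  have zp: "z ^ p = z * z ^ (p - 1)"
  proof -
    have "p = Suc (p - 1)" by (simp add: p_def)
    then show ?thesis by (metis power_Suc)
  qed
  have "fls_deriv (H $ Suc m) = of_nat p * z ^ (p - 1) * h $ Suc m + z ^ p * fls_deriv (h $ Suc m)"
    unfolding Hm by (simp add: fls_deriv_power dz mult_ac)
  also have "of_nat p * z ^ (p - 1) * h $ Suc m = of_nat p * inverse z * H $ Suc m"
  proof -
    have "of_nat p * inverse z * H $ Suc m = (inverse z * z) * (of_nat p * z ^ (p - 1) * h $ Suc m)"
      unfolding Hm zp by (simp only: mult_ac)
    then show ?thesis by (simp only: izz mult_1)
  qed
  \<comment> \<open>The correction term arises from differentiating the factor (1 + y)^p with p = 2
    (N + n - 1); it has the same shape as the second term in fact \<open>1\<close>.\<close>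
  finally have dH: "z ^ p * fls_deriv (h $ Suc m)
    = fls_deriv (H $ Suc m) - 2 * inverse z * (of_nat (N + Suc m) * H $ Suc m)"
    by (simp add: p_def)
  define x where "x = z ^ p * (h $ n + fls_const (1 / of_nat n) * (fls_X_inv * fls_deriv (h $ Suc m)))"
  have n0: "of_nat n * fls_const (1 / of_nat n) = (1 :: 'a fls)"
    using assms(1) by (simp add: fls_of_nat)
  \<comment> \<open>Multiplying by y turns the coefficient of y^(-2) into a residue. The result is a
    y-derivative plus the expression of fact \<open>1\<close>, and both have residue zero.\<close>
  have "of_nat n * (fls_X * x) = fls_X * of_nat n * z ^ p * h $ n
      + (of_nat n * fls_const (1 / of_nat n)) * (fls_X * fls_X_inv) * (z ^ p * fls_deriv (h $ Suc m))"
    unfolding x_def by (simp only: distrib_left mult_ac)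
  also have "\<dots> = fls_deriv (H $ Suc m) + ((inverse z)\<^sup>2 * (fls_X * (of_nat n * H $ n))
      - 2 * inverse z * (of_nat (N + Suc m) * H $ Suc m))"
  proof -
    have "(inverse z)\<^sup>2 * z\<^sup>2 = 1" by (simp only: power_mult_distrib[symmetric] izz power_one)
    moreover have "(inverse z)\<^sup>2 * (fls_X * (of_nat n * H $ n))
      = ((inverse z)\<^sup>2 * z\<^sup>2) * (fls_X * of_nat n * z ^ p * h $ n)"
      unfolding Hn' by (simp only: mult_ac)
    ultimately have *: "(inverse z)\<^sup>2 * (fls_X * (of_nat n * H $ n)) = fls_X * of_nat n * z ^ p * h $ n"
      by (simp only: mult_1)
    show ?thesis unfolding n0 fls_X_mult_X_inv dH * mult_1 by (simp only: add_diff_eq add.commute)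
  qed
  finally have "(of_nat n * (fls_X * x)) $$ (- 1) = 0"
    using 1 by (simp add: fls_deriv_residue del: fls_deriv_nth)
  then have "(fls_X * x) $$ (- 1) = 0"
    unfolding fls_of_nat_mult_nth using assms(1) by simp
  then have "x $$ (- 2) = 0" by (simp add: fls_X_times_conv_shift)
  then show ?thesis by (simp add: x_def h_def p_def z_def m)
qed

section \<open>Grading by the degree in the variables\<close>

lemma poly_mapping_sum_single: "p = (\<Sum>k\<in>Poly_Mapping.keys p. Poly_Mapping.single k (Poly_Mapping.lookup p k))"
  by (rule poly_mapping_eqI)
    (simp add: lookup_sum lookup_single when_def in_keys_iff)

lemma poly_mapping_single_induct [case_names zero single add]:
  assumes "P 0" "\<And>k a. P (Poly_Mapping.single k a)" "\<And>p q. P p \<Longrightarrow> P q \<Longrightarrow> P (p + q)"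
  shows "P (p :: 'm \<Rightarrow>\<^sub>0 'b::comm_monoid_add)"
proof -
  have "P (\<Sum>k\<in>K. Poly_Mapping.single k (Poly_Mapping.lookup p k))" if "finite K" for K
    using that by induction (simp_all add: assms)
  then show ?thesis by (subst poly_mapping_sum_single) simp
qed

definition D_coeff :: "('m \<Rightarrow>\<^sub>0 rat fls) \<Rightarrow> ('m \<Rightarrow>\<^sub>0 rat fls)" where
  "D_coeff p = Poly_Mapping.map (\<lambda>f. fls_X_inv * fls_deriv f) p"

lemma lookup_D_coeff:
  "Poly_Mapping.lookup (D_coeff p) k = fls_X_inv * fls_deriv (Poly_Mapping.lookup p k)"
  by (simp add: D_coeff_def map.rep_eq when_def)

lemma D_coeff_add: "D_coeff (p + q) = D_coeff p + D_coeff q"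
  by (rule poly_mapping_eqI) (simp add: lookup_D_coeff lookup_add distrib_left)

lemma D_coeff_0: "D_coeff 0 = 0"
  by (rule poly_mapping_eqI) (simp add: lookup_D_coeff)

lemma D_coeff_single: "D_coeff (Poly_Mapping.single k f) = Poly_Mapping.single k (fls_X_inv * fls_deriv f)"
  by (rule poly_mapping_eqI) (simp add: lookup_D_coeff lookup_single when_def)

lemma D_coeff_mult:
  fixes p q :: "'m::comm_monoid_add \<Rightarrow>\<^sub>0 rat fls"
  shows "D_coeff (p * q) = D_coeff p * q + p * D_coeff q"
proof (induction p rule: poly_mapping_single_induct)
  case (single k a)
  show ?case
  proof (induction q rule: poly_mapping_single_induct)
    case (single l b)
    show ?case by (simp add: mult_single D_coeff_single single_add[symmetric] algebra_simps)
  qed (simp_all add: D_coeff_0 D_coeff_add algebra_simps)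
qed (simp_all add: D_coeff_0 D_coeff_add algebra_simps)

definition rat_coeff :: "rat \<Rightarrow> ('m::comm_monoid_add \<Rightarrow>\<^sub>0 rat fls)" where
  "rat_coeff q = Poly_Mapping.single 0 (fls_const q)"

interpretation coeff: rational_derivation "D_coeff :: ('m::comm_monoid_add \<Rightarrow>\<^sub>0 rat fls) \<Rightarrow> _" rat_coeff
proof
  show "D_coeff (rat_coeff q * x) = rat_coeff q * D_coeff x" for q and x :: "'m \<Rightarrow>\<^sub>0 rat fls"
    unfolding D_coeff_mult by (simp add: rat_coeff_def D_coeff_single)
qed (simp_all add: D_coeff_add D_coeff_mult rat_coeff_def mult_single single_add[symmetric] fls_plus_const[symmetric])

text \<open>The key (i, \<mu>) stands for v^i c^\<mu>. The variable y sits in the coefficients,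
  where Laurent series provide residues and inverses.\<close>

type_synonym cpoly = "(int \<times> cmono) \<Rightarrow>\<^sub>0 rat fls"

definition lpoly_emb :: "lpoly \<Rightarrow> cpoly" where
  "lpoly_emb p = (\<Sum>k\<in>Poly_Mapping.keys p.
     Poly_Mapping.single (fst k, 0) (fls_const (Poly_Mapping.lookup p k) * fls_X_intpow (snd k)))"

lemma lpoly_emb_add: "lpoly_emb (p + q) = lpoly_emb p + lpoly_emb q"
  unfolding lpoly_emb_def
  by (rule setsum_keys_plus_distrib) (simp_all add: single_add[symmetric] distrib_right fls_plus_const[symmetric])

lemma lpoly_emb_0: "lpoly_emb 0 = 0"
  by (simp add: lpoly_emb_def)

lemma lpoly_emb_sum: "lpoly_emb (sum f I) = (\<Sum>i\<in>I. lpoly_emb (f i))"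
  by (induction I rule: infinite_finite_induct) (simp_all add: lpoly_emb_0 lpoly_emb_add)

lemma lpoly_emb_diff: "lpoly_emb (p - q) = lpoly_emb p - lpoly_emb q"
  using lpoly_emb_add[of "p - q" q] by (simp add: algebra_simps)

lemma lpoly_emb_single:
  "lpoly_emb (Poly_Mapping.single (i, j) a) = Poly_Mapping.single (i, 0) (fls_const a * fls_X_intpow j)"
  by (simp add: lpoly_emb_def)

lemma lpoly_emb_lmono:
  "lpoly_emb (lmono a i j) = Poly_Mapping.single (i, 0) (fls_const a * fls_X_intpow j)"
  by (simp add: lmono_def lpoly_emb_single)

lemma lpoly_emb_mult: "lpoly_emb (p * q) = lpoly_emb p * lpoly_emb q"
proof (induction p rule: poly_mapping_single_induct)
  case (single k a)
  show ?case
  proof (induction q rule: poly_mapping_single_induct)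
    case (single l b)
    have "fls_const (a * b) * fls_X_intpow (snd k + snd l)
      = (fls_const a * fls_X_intpow (snd k)) * (fls_const b * fls_X_intpow (snd l))"
      unfolding fls_X_intpow_times_fls_X_intpow[symmetric] fls_const_mult_const[symmetric]
      by (simp only: mult_ac)
    then show ?case
      by (cases k; cases l) (simp add: mult_single lpoly_emb_single plus_prod_def)
  qed (simp_all add: lpoly_emb_0 lpoly_emb_add algebra_simps)
qed (simp_all add: lpoly_emb_0 lpoly_emb_add algebra_simps)

lemma lpoly_emb_1: "lpoly_emb 1 = 1"
proof -
  have "lpoly_emb (Poly_Mapping.single (0, 0) 1) = Poly_Mapping.single (0, 0) 1"
    by (simp add: lpoly_emb_single)
  then show ?thesis by (simp flip: zero_prod_def)
qed

lemma lpoly_emb_power: "lpoly_emb (p ^ n) = lpoly_emb p ^ n"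
  by (induction n) (simp_all add: lpoly_emb_1 lpoly_emb_mult)

lemma lpoly_emb_ydiff: "lpoly_emb (ydiff p) = D_coeff (lpoly_emb p)"
proof -
  have "lpoly_emb (lmono (of_int j * a) i (j - 2))
      = D_coeff (Poly_Mapping.single (i, 0) (fls_const a * fls_X_intpow j))" for i j a
  proof -
    have "fls_const (of_int j * a) * fls_X_intpow (j - 2)
      = fls_X_inv * fls_deriv (fls_const a * fls_X_intpow j)"
      by (rule fls_eqI) (auto simp: fls_X_inv_times_conv_shift)
    then show ?thesis by (simp add: lpoly_emb_lmono D_coeff_single)
  qed
  then show ?thesis
    unfolding ydiff_def lpoly_emb_sum case_prod_beta lpoly_emb_def[of p] coeff.D_sum by simp
qed

definition cmon :: "cmono \<Rightarrow> cpoly" where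
  "cmon \<mu> = Poly_Mapping.single (0, \<mu>) 1"

lemma cmon_add: "cmon (\<alpha> + \<beta>) = cmon \<alpha> * cmon \<beta>"
  by (simp add: cmon_def mult_single plus_prod_def)

lemma cmon_0: "cmon 0 = 1"
  by (simp add: cmon_def flip: zero_prod_def)

lemma lookup_cmon_mult:
  "Poly_Mapping.lookup (cmon \<mu> * lpoly_emb p) (i, \<nu>) $$ j = (Poly_Mapping.lookup p (i, j) when \<mu> = \<nu>)"
proof (induction p rule: poly_mapping_single_induct)
  case (single k a)
  then show ?case
    by (cases k) (simp add: cmon_def lpoly_emb_single mult_single plus_prod_def lookup_single when_def)
qed (simp_all add: lpoly_emb_0 lpoly_emb_add distrib_left lookup_add when_add_distrib)

section \<open>Monomials of fixed degree in finitely many variables\<close>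

definition monomials :: "nat \<Rightarrow> nat \<Rightarrow> cmono set" where
  "monomials M n = {\<mu>. Poly_Mapping.keys \<mu> \<subseteq> {..M} \<and> (\<Sum>a\<le>M. Poly_Mapping.lookup \<mu> a) = n}"

lemma finite_monomials: "finite (monomials M n)"
proof (rule finite_imageD)
  show "inj_on Poly_Mapping.lookup (monomials M n)"
    by (intro inj_onI) (simp only: lookup_inject)
  have "Poly_Mapping.lookup ` monomials M n
    \<subseteq> {f. \<forall>x. (x \<in> {..M} \<longrightarrow> f x \<in> {..n}) \<and> (x \<notin> {..M} \<longrightarrow> f x = 0)}"
  proof clarify
    fix \<mu> x assume \<mu>: "\<mu> \<in> monomials M n"
    have "Poly_Mapping.lookup \<mu> x \<le> n" if "x \<le> M"
      using \<mu> member_le_sum[of x "{..M}" "Poly_Mapping.lookup \<mu>"] that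
      by (auto simp: monomials_def)
    moreover have "Poly_Mapping.lookup \<mu> x = 0" if "\<not> x \<le> M"
      using \<mu> that by (auto simp: monomials_def in_keys_iff subset_iff)
    ultimately show "(x \<in> {..M} \<longrightarrow> Poly_Mapping.lookup \<mu> x \<in> {..n}) \<and> (x \<notin> {..M} \<longrightarrow> Poly_Mapping.lookup \<mu> x = 0)"
      by auto
  qed
  then show "finite (Poly_Mapping.lookup ` monomials M n)"
    by (rule finite_subset) (rule finite_set_of_finite_funs; simp)
qed

lemma keys_add_cmono: "Poly_Mapping.keys (\<alpha> + \<beta> :: cmono) = Poly_Mapping.keys \<alpha> \<union> Poly_Mapping.keys \<beta>"
  by (auto simp: in_keys_iff lookup_add)

lemma monomials_add:
  assumes "\<alpha> \<in> monomials M i" "\<beta> \<in> monomials M j"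
  shows "\<alpha> + \<beta> \<in> monomials M (i + j)"
  using assms by (simp add: monomials_def keys_add_cmono lookup_add sum.distrib)

lemma monomials_addE:
  assumes "\<alpha> + \<beta> \<in> monomials M n"
  obtains i where "i \<le> n" "\<alpha> \<in> monomials M i" "\<beta> \<in> monomials M (n - i)"
  using assms by (auto simp: monomials_def keys_add_cmono lookup_add sum.distrib)

text \<open>The bound \<open>M\<close> may be taken as large as desired, so that the truncation
  keeps both \<mu> and the variable c_N.\<close>

lemma ex_monomials:
  obtains M n where "M \<ge> N" "\<mu> \<in> monomials M n"
proof -
  obtain K where "Poly_Mapping.keys \<mu> \<subseteq> {..K}"
    using finite_nat_iff_bounded_le[of "Poly_Mapping.keys \<mu>"] by auto
  then have "\<mu> \<in> monomials (max K N) (\<Sum>a\<le>max K N. Poly_Mapping.lookup \<mu> a)"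
    unfolding monomials_def by (auto simp: subset_iff le_max_iff_disj)
  then show ?thesis by (rule that[rotated]) simp
qed

lemma finite_add_pairs: "finite {(\<alpha>, \<beta>). \<alpha> + \<beta> = (\<mu> :: cmono)}"
proof -
  obtain M n where \<mu>: "\<mu> \<in> monomials M n" using ex_monomials[of 0 \<mu>] by blast
  have "{(\<alpha>, \<beta>). \<alpha> + \<beta> = \<mu>} \<subseteq> (\<Union>i\<le>n. monomials M i) \<times> (\<Union>i\<le>n. monomials M i)"
  proof
    fix x assume "x \<in> {(\<alpha>, \<beta>). \<alpha> + \<beta> = \<mu>}"
    then obtain \<alpha> \<beta> where x: "x = (\<alpha>, \<beta>)" and "\<alpha> + \<beta> = \<mu>" by auto
    then obtain i where "i \<le> n" "\<alpha> \<in> monomials M i" "\<beta> \<in> monomials M (n - i)"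
      using \<mu> by (auto elim: monomials_addE)
    then show "x \<in> (\<Union>i\<le>n. monomials M i) \<times> (\<Union>i\<le>n. monomials M i)"
      by (auto simp: x intro: bexI[of _ "n - i"])
  qed
  then show ?thesis by (rule finite_subset) (simp add: finite_monomials)
qed

lemma zero_in_monomials: "0 \<in> monomials M n \<longleftrightarrow> n = 0"
  by (auto simp: monomials_def)

text \<open>The power series variable records the total degree in the \<open>c\<^sub>a\<close>; dropping all \<open>c\<^sub>a\<close> with
  \<open>a > M\<close> makes the homogeneous components polynomials.\<close>

definition graded :: "nat \<Rightarrow> cser \<Rightarrow> cpoly fps" where
  "graded M F = Abs_fps (\<lambda>n. \<Sum>\<mu>\<in>monomials M n. cmon \<mu> * lpoly_emb (F \<mu>))"

lemma lookup_graded: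
  assumes "\<mu> \<in> monomials M n"
  shows "Poly_Mapping.lookup (graded M F $ n) (i, \<mu>) $$ j = Poly_Mapping.lookup (F \<mu>) (i, j)"
proof -
  have *: "sum f I $$ j = (\<Sum>x\<in>I. f x $$ j)" for f :: "cmono \<Rightarrow> rat fls" and I
    by (induction I rule: infinite_finite_induct) simp_all
  show ?thesis
    using assms by (simp add: graded_def lookup_sum * lookup_cmon_mult when_def finite_monomials)
qed

lemma graded_nth_eq_0D:
  assumes "graded M F $ n = 0" "\<mu> \<in> monomials M n"
  shows "F \<mu> = 0"
proof (rule poly_mapping_eqI)
  show "Poly_Mapping.lookup (F \<mu>) k = Poly_Mapping.lookup 0 k" for k
    using lookup_graded[OF assms(2), of F "fst k" "snd k"] assms(1) by simp
qed

lemma graded_add: "graded M (ser_add F G) = graded M F + graded M G"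
  by (rule fps_ext) (simp add: graded_def ser_add_def lpoly_emb_add distrib_left sum.distrib)

lemma graded_diff: "graded M (ser_diff F G) = graded M F - graded M G"
  by (rule fps_ext) (simp add: graded_def ser_diff_def lpoly_emb_diff right_diff_distrib sum_subtractf)

lemma graded_const: "graded M (ser_const p) = fps_const (lpoly_emb p)"
proof (rule fps_ext)
  fix n
  have "(\<Sum>\<mu>\<in>monomials M n. cmon \<mu> * lpoly_emb (ser_const p \<mu>))
    = (\<Sum>\<mu>\<in>monomials M n. if \<mu> = 0 then lpoly_emb p else 0)"
    by (intro sum.cong) (simp_all add: ser_const_def cmon_0 lpoly_emb_0)
  then show "graded M (ser_const p) $ n = fps_const (lpoly_emb p) $ n"
    by (simp add: graded_def finite_monomials zero_in_monomials)
qed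

lemma graded_scale: "graded M (ser_scale a F) = fps_const (rat_coeff a) * graded M F"
  by (rule fps_ext) (simp add: graded_def ser_scale_def lpoly_emb_mult lpoly_emb_lmono
      rat_coeff_def zero_prod_def sum_distrib_left mult_ac)

lemma graded_ydiff: "graded M (ser_ydiff F) = coeff.D_fps (graded M F)"
proof (rule fps_ext)
  have "D_coeff (cmon \<mu>) = 0" for \<mu> by (simp add: cmon_def D_coeff_single)
  then show "graded M (ser_ydiff F) $ n = coeff.D_fps (graded M F) $ n" for n
    by (simp add: graded_def ser_ydiff_def lpoly_emb_ydiff coeff.D_sum D_coeff_mult)
qed

text \<open>Factors of a monomial in c_0, ..., c_M involve only these variables, and degrees add;
  hence truncation and grading respect the Cauchy product.\<close>

lemma graded_mult: "graded M (ser_mult F G) = graded M F * graded M G"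
proof (rule fps_ext)
  fix n
  define g where "g = (\<lambda>(\<alpha>, \<beta>). cmon \<alpha> * lpoly_emb (F \<alpha>) * (cmon \<beta> * lpoly_emb (G \<beta>)))"
  define S :: "cmono \<Rightarrow> (cmono \<times> cmono) set" where "S = (\<lambda>\<mu>. {(\<alpha>, \<beta>). \<alpha> + \<beta> = \<mu>})"
  have fin: "finite (S \<mu>)" for \<mu>
    unfolding S_def by (rule finite_add_pairs)
  have "graded M (ser_mult F G) $ n = (\<Sum>\<mu>\<in>monomials M n. \<Sum>x\<in>S \<mu>. g x)"
    unfolding graded_def ser_mult_def fps_nth_Abs_fps lpoly_emb_sum sum_distrib_left S_def g_def
    by (intro sum.cong refl) (auto simp: lpoly_emb_mult cmon_add mult_ac)
  also have "\<dots> = (\<Sum>(\<mu>, x)\<in>Sigma (monomials M n) S. g x)"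
    by (rule sum.Sigma) (auto simp: finite_monomials fin)
  also have "\<dots> = (\<Sum>(i, x)\<in>(SIGMA i:{0..n}. monomials M i \<times> monomials M (n - i)). g x)"
  \<comment> \<open>The sum over splittings is regrouped by the degree \<open>i\<close> of the first
    factor, which \<alpha> determines.\<close>
  proof (rule sum.reindex_bij_witness[where
      i = "\<lambda>(i, \<alpha>, \<beta>). (\<alpha> + \<beta>, \<alpha>, \<beta>)" and
      j = "\<lambda>(\<mu>, \<alpha>, \<beta>). (\<Sum>a\<le>M. Poly_Mapping.lookup \<alpha> a, \<alpha>, \<beta>)"], goal_cases)
    case (2 x)
    then obtain \<alpha> \<beta> where x: "x = (\<alpha> + \<beta>, \<alpha>, \<beta>)" and "\<alpha> + \<beta> \<in> monomials M n"
      by (auto simp: S_def)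
    then obtain i where "i \<le> n" "\<alpha> \<in> monomials M i" "\<beta> \<in> monomials M (n - i)"
      by (elim monomials_addE)
    then show ?case by (auto simp: x monomials_def)
  next
    case (4 x)
    then obtain i \<alpha> \<beta> where x: "x = (i, \<alpha>, \<beta>)" and "i \<le> n" "\<alpha> \<in> monomials M i" "\<beta> \<in> monomials M (n - i)"
      by auto
    then show ?case using monomials_add[of \<alpha> M i \<beta> "n - i"] by (simp add: S_def)
  qed (auto simp: S_def monomials_def)
  also have "\<dots> = (\<Sum>i=0..n. \<Sum>x\<in>monomials M i \<times> monomials M (n - i). g x)"
    by (rule sum.Sigma[symmetric]) (auto simp: finite_monomials)
  also have "\<dots> = (graded M F * graded M G) $ n"
    unfolding fps_mult_nth graded_def fps_nth_Abs_fps sum_product sum.cartesian_product g_def ..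
  finally show "graded M (ser_mult F G) $ n = (graded M F * graded M G) $ n" .
qed

lemma graded_1: "graded M (ser_const 1) = 1"
  by (simp add: graded_const lpoly_emb_1)

lemma graded_pow: "graded M (ser_pow F n) = graded M F ^ n"
  by (induction n) (simp_all add: graded_1 graded_mult)

text \<open>If the r-th member starts in degree r, then a monomial of degree n sees only members
  with r \<le> n, so the support-indexed sum can be taken over that range.\<close>

lemma graded_suminf:
  assumes "\<And>r n. n < r \<Longrightarrow> graded M (f r) $ n = 0"
  shows "graded M (ser_suminf f) = Abs_fps (\<lambda>n. \<Sum>r\<le>n. graded M (f r) $ n)"
proof (rule fps_ext)
  fix n
  have "ser_suminf f \<mu> = (\<Sum>r\<le>n. f r \<mu>)" if "\<mu> \<in> monomials M n" for \<mu>
  proof -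
    have "f r \<mu> = 0" if "n < r" for r
      using assms[OF that] \<open>\<mu> \<in> monomials M n\<close> by (rule graded_nth_eq_0D)
    then have "{r. f r \<mu> \<noteq> 0} \<subseteq> {..n}" by (auto simp: not_less[symmetric])
    then show ?thesis unfolding ser_suminf_def by (intro sum.mono_neutral_left) auto
  qed
  then have "graded M (ser_suminf f) $ n = (\<Sum>\<mu>\<in>monomials M n. \<Sum>r\<le>n. cmon \<mu> * lpoly_emb (f r \<mu>))"
    by (simp add: graded_def lpoly_emb_sum sum_distrib_left)
  also have "\<dots> = (\<Sum>r\<le>n. graded M (f r) $ n)"
    unfolding graded_def fps_nth_Abs_fps by (rule sum.swap)
  finally show "graded M (ser_suminf f) $ n = Abs_fps (\<lambda>n. \<Sum>r\<le>n. graded M (f r) $ n) $ n"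
    by simp
qed

section \<open>The graded forms of \<open>A_ser\<close> and \<open>T_ser\<close>\<close>

lemma ser_mult_cvar_const:
  "ser_mult (cvar a) (ser_const p) \<mu> = (if \<mu> = Poly_Mapping.single a 1 then p else 0)"
proof -
  have "ser_mult (cvar a) (ser_const p) \<mu>
    = (\<Sum>x\<in>{(\<alpha>, \<beta>). \<alpha> + \<beta> = \<mu>}. if x = (\<mu>, 0) then cvar a \<mu> * p else 0)"
    unfolding ser_mult_def by (intro sum.cong refl) (auto simp: ser_const_def split: if_splits)
  also have "\<dots> = cvar a \<mu> * p"
    using finite_add_pairs[of \<mu>] by (simp add: sum.delta')
  finally show ?thesis by (simp add: cvar_def)
qed

lemma single_1_eq_iff: "Poly_Mapping.single a (1::nat) = Poly_Mapping.single b 1 \<longleftrightarrow> a = b"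
  by (metis keys_single singleton_inject one_neq_zero)

lemma A_ser_single:
  "A_ser (Poly_Mapping.single a 1) = lmono 1 (int a - 1) 0 * (1 + lmono 1 0 1) ^ (2 * a)"
  (is "_ = ?q a")
proof -
  have "A_ser (Poly_Mapping.single a 1) = (\<Sum>r\<in>{a}. if r = a then ?q r else 0)"
    unfolding A_ser_def ser_suminf_def ser_mult_cvar_const
    by (rule sum.mono_neutral_cong_left) (auto simp: single_1_eq_iff[unfolded One_nat_def])
  then show ?thesis by simp
qed

lemma A_ser_other: "(\<And>a. \<mu> \<noteq> Poly_Mapping.single a 1) \<Longrightarrow> A_ser \<mu> = 0"
  by (simp add: A_ser_def ser_suminf_def ser_mult_cvar_const)

definition coeff_emb :: "rat fls \<Rightarrow> cpoly" where
  "coeff_emb f = Poly_Mapping.single 0 f"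

lemma coeff_emb_add: "coeff_emb (f + g) = coeff_emb f + coeff_emb g"
  and coeff_emb_mult: "coeff_emb (f * g) = coeff_emb f * coeff_emb g"
  and coeff_emb_1: "coeff_emb 1 = 1"
  and coeff_emb_0: "coeff_emb 0 = 0"
  and D_coeff_emb: "D_coeff (coeff_emb f) = coeff_emb (fls_X_inv * fls_deriv f)"
  and rat_coeff_eq: "rat_coeff q = coeff_emb (fls_const q)"
  by (simp_all add: coeff_emb_def single_add mult_single D_coeff_single rat_coeff_def)

lemma coeff_emb_double: "coeff_emb (2 * f) = 2 * coeff_emb f"
  by (simp only: mult_2 coeff_emb_add)

lemma coeff_emb_sum: "coeff_emb (sum f I) = (\<Sum>i\<in>I. coeff_emb (f i))"
  by (induction I rule: infinite_finite_induct) (simp_all add: coeff_emb_0 coeff_emb_add)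

lemma coeff_emb_power: "coeff_emb (f ^ n) = coeff_emb f ^ n"
  by (induction n) (simp_all add: coeff_emb_1 coeff_emb_mult)

lemma lpoly_emb_lmono_y: "lpoly_emb (lmono a 0 j) = coeff_emb (fls_const a * fls_X_intpow j)"
  by (simp add: lpoly_emb_lmono coeff_emb_def flip: zero_prod_def)

text \<open>The degree-one component of the truncated A; the variable X that records the degree is
  supplied separately in \<open>graded_A_ser\<close>.\<close>

definition A_poly :: "nat \<Rightarrow> cpoly" where
  "A_poly M = (\<Sum>a\<le>M. Poly_Mapping.single (int a - 1, Poly_Mapping.single a 1) ((1 + fls_X) ^ (2 * a)))"

lemma single_in_monomials: "Poly_Mapping.single a 1 \<in> monomials M n \<longleftrightarrow> a \<le> M \<and> n = 1"
  by (auto simp: monomials_def lookup_single when_def)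

lemma graded_A_ser: "graded M A_ser = fps_X * fps_const (A_poly M)"
proof (rule fps_ext)
  fix n :: nat
  let ?T = "(\<lambda>a. Poly_Mapping.single a 1) ` {a. a \<le> M \<and> n = 1}"
  have q: "lpoly_emb (lmono 1 (int a - 1) 0 * (1 + lmono 1 0 1) ^ (2 * a))
      = Poly_Mapping.single (int a - 1, 0) ((1 + fls_X) ^ (2 * a))" for a
  proof -
    have "lpoly_emb (1 + lmono 1 0 1) = coeff_emb (1 + fls_X)"
      by (simp add: lpoly_emb_add lpoly_emb_1 lpoly_emb_lmono_y coeff_emb_add coeff_emb_1
          fls_X_conv_shift_1[symmetric])
    then have "lpoly_emb (lmono 1 (int a - 1) 0 * (1 + lmono 1 0 1) ^ (2 * a))
        = Poly_Mapping.single (int a - 1, 0) 1 * coeff_emb ((1 + fls_X) ^ (2 * a))"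
      by (simp add: lpoly_emb_mult lpoly_emb_power lpoly_emb_lmono coeff_emb_power)
    then show ?thesis
      by (simp add: coeff_emb_def mult_single plus_prod_def)
  qed
  have "graded M A_ser $ n = (\<Sum>\<mu>\<in>?T. cmon \<mu> * lpoly_emb (A_ser \<mu>))"
    unfolding graded_def fps_nth_Abs_fps
  proof (rule sum.mono_neutral_right)
    show "\<forall>\<mu>\<in>monomials M n - ?T. cmon \<mu> * lpoly_emb (A_ser \<mu>) = 0"
    proof
      fix \<mu> assume "\<mu> \<in> monomials M n - ?T"
      then have "A_ser \<mu> = 0" by (intro A_ser_other) (auto simp: single_in_monomials[unfolded One_nat_def])
      then show "cmon \<mu> * lpoly_emb (A_ser \<mu>) = 0" by (simp add: lpoly_emb_0)
    qed
  qed (auto simp: finite_monomials single_in_monomials[unfolded One_nat_def])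
  also have "\<dots> = (\<Sum>a\<in>{a. a \<le> M \<and> n = 1}. cmon (Poly_Mapping.single a 1) * lpoly_emb (A_ser (Poly_Mapping.single a 1)))"
    by (rule sum.reindex[unfolded o_def]) (simp add: inj_on_def single_1_eq_iff[unfolded One_nat_def])
  also have "\<dots> = (\<Sum>a\<in>{a. a \<le> M \<and> n = 1}.
      Poly_Mapping.single (int a - 1, Poly_Mapping.single a 1) ((1 + fls_X) ^ (2 * a)))"
    unfolding A_ser_single q by (simp add: cmon_def mult_single plus_prod_def)
  also have "\<dots> = (fps_X * fps_const (A_poly M)) $ n"
    by (cases "n = 1") (simp_all add: A_poly_def atMost_def fps_X_def)
  finally show "graded M A_ser $ n = (fps_X * fps_const (A_poly M)) $ n" .
qed

lemma D_fps_funpow_nth: "(coeff.D_fps ^^ k) f $ n = (D_coeff ^^ k) (f $ n)"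
  by (induction k) simp_all

lemma graded_ydiff_funpow: "graded M ((ser_ydiff ^^ k) F) = (coeff.D_fps ^^ k) (graded M F)"
  by (induction k) (simp_all add: graded_ydiff)

text \<open>A primitive of (1 + y)/y for the derivation (1/y) d/dy; it makes the sum defining
  \<open>T_ser\<close> a Lagrange series.\<close>

definition y_prim :: "rat fls" where
  "y_prim = fls_X + fls_const (1 / 2) * fls_X\<^sup>2"

lemma deriv_half_X_power2: "fls_X_inv * fls_deriv (fls_const (1 / 2) * fls_X\<^sup>2) = (1 :: rat fls)"
proof -
  have "fls_deriv (fls_const (1 / 2) * fls_X\<^sup>2) = (2 * fls_const (1 / 2) :: rat fls) * fls_X"
    unfolding power2_eq_square fls_deriv_mult fls_deriv_const fls_deriv_X mult_2
    by (simp only: mult_zero_left add_0_right mult_1 mult_1_right distrib_left distrib_right)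
  then show ?thesis
    unfolding fls_const_half using fls_X_mult_X_inv[where 'a = rat] by (simp add: mult.commute)
qed

lemma graded_T_ser:
  "graded M T_ser = fps_const (coeff_emb fls_X)
     + (coeff.lagr (A_poly M) (coeff_emb y_prim) - fps_const (coeff_emb y_prim))"
proof -
  define f where "f = (\<lambda>r. if r = 0 then (\<lambda>_. 0) else
        ser_scale (1 / fact r)
          ((ser_ydiff ^^ (r - 1))
             (ser_mult (ser_const (lmono 1 0 (-1) + 1)) (ser_pow A_ser r))))"
  have Dp: "D_coeff (coeff_emb y_prim) = lpoly_emb (lmono 1 0 (-1) + 1)"
  proof -
    have "fls_X_inv * fls_deriv y_prim = fls_X_inv + 1"
      unfolding y_prim_def fls_deriv_add distrib_left deriv_half_X_power2 by simp
    then show ?thesis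
      by (simp add: D_coeff_emb lpoly_emb_add lpoly_emb_1 lpoly_emb_lmono_y coeff_emb_add
          coeff_emb_1 fls_X_inv_conv_shift_1[symmetric])
  qed
  \<comment> \<open>The r-th summand contains \<open>A_ser\<close> to the power r and is therefore
    homogeneous of degree r.\<close>
  have f_nth: "graded M (f r) $ n = (if r = n then if n = 0 then 0 else
      rat_coeff (1 / fact n) * (D_coeff ^^ (n - 1)) (D_coeff (coeff_emb y_prim) * A_poly M ^ n) else 0)" for r n
  proof (cases "r = 0")
    case True
    then show ?thesis by (simp add: f_def graded_def lpoly_emb_0)
  next
    case False
    have "(fps_const c * (fps_X * fps_const a) ^ r) $ n = (if n = r then c * a ^ r else 0)" for c a :: cpoly
      by (auto simp: power_mult_distrib fps_const_power fps_X_power_mult_nth mult.commute[of _ "fps_const _"] 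
          mult.left_commute[of "fps_X ^ _"] mult.assoc)
    then show ?thesis using False
      by (simp add: f_def graded_scale graded_ydiff_funpow D_fps_funpow_nth graded_mult graded_const
          graded_pow graded_A_ser Dp coeff.D_funpow_0)
  qed
  have "graded M (ser_suminf f) = Abs_fps (\<lambda>n. \<Sum>r\<le>n. graded M (f r) $ n)"
    by (rule graded_suminf) (simp add: f_nth)
  also have "\<dots> = coeff.lagr (A_poly M) (coeff_emb y_prim) - fps_const (coeff_emb y_prim)"
    by (rule fps_ext) (simp add: f_nth coeff.lagr_def)
  finally show ?thesis
    by (simp add: T_ser_def f_def graded_add graded_const lpoly_emb_lmono_y fls_X_conv_shift_1[symmetric])
qed

section \<open>Substituting X A for X, and the negative power of (T + y)/2\<close>

definition subst_ser :: "cpoly \<Rightarrow> rat fls fps \<Rightarrow> cpoly fps" where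
  "subst_ser A f = Abs_fps (\<lambda>k. coeff_emb (f $ k) * A ^ k)"

lemma subst_ser_nth: "subst_ser A f $ k = coeff_emb (f $ k) * A ^ k"
  by (simp add: subst_ser_def)

lemma subst_ser_add: "subst_ser A (f + g) = subst_ser A f + subst_ser A g"
  by (rule fps_ext) (simp add: subst_ser_nth coeff_emb_add distrib_right)

lemma subst_ser_diff: "subst_ser A (f - g) = subst_ser A f - subst_ser A g"
  using subst_ser_add[of A "f - g" g] by (simp add: algebra_simps)

lemma subst_ser_mult: "subst_ser A (f * g) = subst_ser A f * subst_ser A g"
proof (rule fps_ext)
  fix n
  have "coeff_emb (f $ i * g $ (n - i)) * A ^ n
      = (coeff_emb (f $ i) * A ^ i) * (coeff_emb (g $ (n - i)) * A ^ (n - i))" if "i \<le> n" for i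
  proof -
    have "A ^ n = A ^ i * A ^ (n - i)" using that by (simp flip: power_add)
    then show ?thesis by (simp add: coeff_emb_mult mult_ac)
  qed
  then show "subst_ser A (f * g) $ n = (subst_ser A f * subst_ser A g) $ n"
    by (simp add: subst_ser_nth fps_mult_nth coeff_emb_sum sum_distrib_right)
qed

lemma subst_ser_const: "subst_ser A (fps_const c) = fps_const (coeff_emb c)"
  by (rule fps_ext) (simp add: subst_ser_nth coeff_emb_0)

lemma subst_ser_X: "subst_ser A fps_X = fps_X * fps_const A"
  by (rule fps_ext) (simp add: subst_ser_nth coeff_emb_0 coeff_emb_1 fps_X_def)

lemma subst_ser_1: "subst_ser A 1 = 1"
  using subst_ser_const[of A 1] by (simp add: coeff_emb_1)

lemma subst_ser_power: "subst_ser A (f ^ n) = subst_ser A f ^ n"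
  by (induction n) (simp_all add: subst_ser_1 subst_ser_mult)

lemma lagr_half_X_power2:
  "coeff.lagr A (coeff_emb (fls_const (1 / 2) * fls_X\<^sup>2))
    = fps_const (coeff_emb (fls_const (1 / 2) * fls_X\<^sup>2)) + fps_X * coeff.lagr A A"
  by (rule coeff.lagr_D_eq_1) (simp only: D_coeff_emb deriv_half_X_power2 coeff_emb_1)

lemma lagr_ext_X_const: "coeff.lagr_ext A (fps_X * fps_const B) = fps_X * coeff.lagr A B"
  by (simp add: coeff.lagr_ext_X coeff.lagr_ext_const)

text \<open>In terms of \<open>U = u + X A(U)\<close>, \<open>u = y\<^sup>2/2\<close>: since \<open>u = U - X A(U)\<close>, the substitution
  \<open>y \<mapsto> Y = sqrt (2U)\<close> maps \<open>sqrt (y\<^sup>2 - 2 X A)\<close> back to \<open>y\<close>.\<close>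

lemma lagr_ext_sqrt: "coeff.lagr_ext A (subst_ser A sqrt_ser) = fps_const (coeff_emb fls_X)"
proof -
  define u :: "rat fls" where "u = fls_const (1 / 2) * fls_X\<^sup>2"
  have uu: "u + u = fls_X\<^sup>2"
    unfolding u_def mult_2[symmetric] mult.assoc[symmetric] fls_const_half by simp
  define U where "U = coeff.lagr_ext A (subst_ser A sqrt_ser)"
  define y where "y = fps_const (coeff_emb fls_X)"
  have "U * U = coeff.lagr_ext A (subst_ser A (fps_const u - fps_X + (fps_const u - fps_X)))"
  proof -
    have "sqrt_ser * sqrt_ser = fps_const u - fps_X + (fps_const u - fps_X)"
      unfolding power2_eq_square[symmetric] sqrt_ser_power2 uu[symmetric] mult_2
        fps_const_add[symmetric] by (rule add_diff_add)
    then show ?thesis unfolding U_def by (simp only: coeff.lagr_ext_mult[symmetric] subst_ser_mult[symmetric])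
  qed
  also have "coeff.lagr_ext A (subst_ser A (fps_const u - fps_X)) = fps_const (coeff_emb u)"
    by (simp add: subst_ser_diff subst_ser_const subst_ser_X coeff.lagr_ext_diff coeff.lagr_ext_const
        lagr_ext_X_const lagr_half_X_power2 u_def)
  then have "coeff.lagr_ext A (subst_ser A (fps_const u - fps_X + (fps_const u - fps_X))) = fps_const (coeff_emb (u + u))"
    by (simp only: subst_ser_add coeff.lagr_ext_add coeff_emb_add fps_const_add)
  also have "\<dots> = y * y" by (simp add: uu y_def coeff_emb_mult power2_eq_square)
  finally have "(U + y) * (U - y) = 0" by (simp add: algebra_simps)
  \<comment> \<open>The sign of the square root is decided by the constant coefficient 2y of
    \<open>U + y\<close>, which is a unit.\<close>
  then have "U - y = 0"
  proof (rule fps_mult_left_cancel_unit)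
    have "(U + y) $ 0 = coeff_emb (fls_X + fls_X)"
      by (simp add: U_def y_def coeff.lagr_ext_0 subst_ser_nth sqrt_ser_0 coeff_emb_double)
    moreover have "(fls_const (1 / 2) * fls_X_inv) * (fls_X + fls_X) = (1 :: rat fls)"
      using fls_const_half[where 'a = rat] fls_X_mult_X_inv[where 'a = rat] by algebra
    ultimately show "coeff_emb (fls_const (1 / 2) * fls_X_inv) * (U + y) $ 0 = 1"
      by (simp only: coeff_emb_mult[symmetric] coeff_emb_1)
  qed
  then show ?thesis by (simp add: U_def y_def)
qed

text \<open>The Lagrange series of y + y^2/2 gives T = Y + X A(Y), and the added y is the image of
  \<open>sqrt_ser\<close> by \<open>lagr_ext_sqrt\<close>. The sum is thus the image of
  \<open>half_sum_ser\<close> term by term.\<close>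

lemma graded_half_sum:
  "graded M (ser_scale (1/2) (ser_add T_ser (ser_const (lmono 1 0 1))))
    = coeff.lagr_ext (A_poly M) (subst_ser (A_poly M) half_sum_ser)"
proof -
  define A where "A = A_poly M"
  define y where "y = fps_const (coeff_emb fls_X)"
  define h :: "rat fls" where "h = fls_const (1 / 2)"
  define c where "c = fps_const (coeff_emb h)"
  have "graded M (ser_scale (1/2) (ser_add T_ser (ser_const (lmono 1 0 1))))
    = c * (graded M T_ser + y)"
    by (simp add: graded_scale graded_add graded_const lpoly_emb_lmono_y c_def h_def y_def rat_coeff_eq
        fls_X_conv_shift_1[symmetric])
  also have "graded M T_ser + y = coeff.lagr A (coeff_emb fls_X) + fps_X * coeff.lagr A A + y"
    unfolding graded_T_ser y_prim_def coeff_emb_add coeff.lagr_add lagr_half_X_power2 A_def y_def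
    by (simp flip: fps_const_add)
  also have "c * \<dots> = coeff.lagr_ext A (subst_ser A half_sum_ser)"
  proof -
    have h: "1 / 2 = h"
      using fls_const_half[where 'a = rat] by (simp add: h_def field_simps)
    have "coeff.lagr_ext A (subst_ser A fps_X) = fps_X * coeff.lagr A A"
      by (simp only: subst_ser_X lagr_ext_X_const)
    moreover have "coeff.lagr A (coeff_emb h) = c"
      unfolding c_def by (rule coeff.lagr_const) (simp add: h_def D_coeff_emb coeff_emb_0)
    ultimately show ?thesis
      unfolding half_sum_ser_def h subst_ser_mult subst_ser_add subst_ser_const
        coeff.lagr_ext_mult coeff.lagr_ext_add lagr_ext_sqrt coeff.lagr_ext_const
      by (simp only: y_def)
  qed
  finally show ?thesis by (simp add: A_def)
qed

text \<open>Both sides are inverse to the N-th power of the image of \<open>half_sum_ser\<close>: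
  the left by the binomial series, the right because \<open>lagr_ext\<close> and
  \<open>subst_ser\<close> are multiplicative. Inverses are unique.\<close>

lemma graded_neg_pow:
  "graded M (ser_neg_pow_y (ser_scale (1/2) (ser_add T_ser (ser_const (lmono 1 0 1)))) N)
    = coeff.lagr_ext (A_poly M) (subst_ser (A_poly M) (inv_pow_ser N))"
proof -
  define S where "S = ser_scale (1/2) (ser_add T_ser (ser_const (lmono 1 0 1)))"
  define s where "s = coeff.lagr_ext (A_poly M) (subst_ser (A_poly M) half_sum_ser)"
  define G where "G = coeff.lagr_ext (A_poly M) (subst_ser (A_poly M) (inv_pow_ser N))"
  have S: "graded M S = s" unfolding S_def s_def by (rule graded_half_sum)
  have G: "G * s ^ N = 1"
    unfolding G_def s_def coeff.lagr_ext_power[symmetric] subst_ser_power[symmetric]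
      coeff.lagr_ext_mult[symmetric] subst_ser_mult[symmetric] inv_pow_ser_mult
    by (simp add: subst_ser_1 coeff.lagr_ext_1)
  define y where "y = fps_const (coeff_emb fls_X)"
  define yi where "yi = fps_const (coeff_emb fls_X_inv)"
  have y: "yi * y = 1"
    unfolding y_def yi_def by (simp add: coeff_emb_mult[symmetric] fls_X_mult_X_inv mult.commute[of fls_X_inv] coeff_emb_1)
  define eps where "eps = ser_diff (ser_mult (ser_const (lmono 1 0 (-1))) S) (ser_const 1)"
  define e where "e = graded M eps"
  have e: "e = yi * s - 1"
    by (simp add: e_def eps_def graded_diff graded_mult graded_const lpoly_emb_lmono_y lpoly_emb_1 S yi_def
        fls_X_inv_conv_shift_1[symmetric])
  have "s $ 0 = coeff_emb fls_X"
    by (simp add: s_def coeff.lagr_ext_0 subst_ser_nth half_sum_ser_0)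
  then have "e $ 0 = (yi * y) $ 0 - 1" by (simp add: e y_def)
  then have e0: "e $ 0 = 0" by (simp add: y)
  define B where "B = Abs_fps (\<lambda>k. rat_coeff ((- of_nat N) gchoose k)) oo e"
  have B: "(1 + e) ^ N * B = 1" unfolding B_def by (rule coeff.binomial_series_mult[OF e0])
  have ez: "e ^ k $ m = 0" if "m < k" for k m
    using that e0 by (metis startsby_zero_power_prefix)
  have "graded M (ser_suminf (\<lambda>k. ser_scale ((- of_nat N :: rat) gchoose k) (ser_pow eps k))) = B"
  proof -
    have "graded M (ser_suminf (\<lambda>k. ser_scale ((- of_nat N :: rat) gchoose k) (ser_pow eps k)))
       = Abs_fps (\<lambda>n. \<Sum>r\<le>n. graded M (ser_scale ((- of_nat N :: rat) gchoose r) (ser_pow eps r)) $ n)"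
      by (rule graded_suminf) (simp add: graded_scale graded_pow e_def[symmetric] ez)
    also have "\<dots> = B"
      by (rule fps_ext) (simp add: B_def fps_compose_nth graded_scale graded_pow e_def[symmetric] atLeast0AtMost)
    finally show ?thesis .
  qed
  moreover have "lpoly_emb (lmono 1 0 (- int N)) = coeff_emb (fls_X_inv ^ N)"
    by (simp add: lpoly_emb_lmono_y fls_X_inv_power_conv_shift_1)
  ultimately have neg: "graded M (ser_neg_pow_y S N) = yi ^ N * B"
    by (simp add: ser_neg_pow_y_def Let_def eps_def[symmetric] graded_mult graded_const yi_def
        coeff_emb_power fps_const_power)
  have "s = y * (1 + e)" using y unfolding e by (simp add: algebra_simps)
  then have "yi ^ N * B * s ^ N = (yi * y) ^ N * ((1 + e) ^ N * B)"
    by (simp only: power_mult_distrib mult_ac)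
  then have "yi ^ N * B * s ^ N = 1" by (simp add: y B)
  then have "G * (yi ^ N * B * s ^ N) = G" by simp
  moreover have "G * (yi ^ N * B * s ^ N) = (G * s ^ N) * (yi ^ N * B)" by (simp only: mult_ac)
  ultimately have "G = yi ^ N * B" using G by simp
  with neg show ?thesis by (simp add: S_def G_def)
qed

section \<open>Extraction of the coefficient\<close>

lemma lookup_mult_coeff_emb:
  "Poly_Mapping.lookup (p * coeff_emb f) k = Poly_Mapping.lookup p k * f"
proof (induction p rule: poly_mapping_single_induct)
  case (single l a)
  then show ?case by (simp add: coeff_emb_def mult_single lookup_single when_def)
qed (simp_all add: lookup_add distrib_right)

lemma lookup_single_mult:
  fixes P :: cpoly
  shows "Poly_Mapping.lookup (Poly_Mapping.single k a * P) (k + m) = a * Poly_Mapping.lookup P m"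
proof (induction P rule: poly_mapping_single_induct)
  case (single l b)
  then show ?case by (simp add: mult_single lookup_single when_def)
qed (simp_all add: lookup_add distrib_left)

lemma lookup_single_mult_eq_0:
  fixes P :: cpoly
  assumes "\<And>m. l \<noteq> k + m"
  shows "Poly_Mapping.lookup (Poly_Mapping.single k a * P) l = 0"
proof (induction P rule: poly_mapping_single_induct)
  case (single m b)
  then show ?case using assms[of m] by (simp add: mult_single lookup_single when_def eq_commute)
qed (simp_all add: lookup_add distrib_left)

definition weight :: "nat \<Rightarrow> cmono \<Rightarrow> nat" where
  "weight M \<mu> = (\<Sum>a\<le>M. a * Poly_Mapping.lookup \<mu> a)"

lemma weight_add: "weight M (\<alpha> + \<beta>) = weight M \<alpha> + weight M \<beta>"
  by (simp add: weight_def lookup_add distrib_left sum.distrib)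

lemma weight_single: "a \<le> M \<Longrightarrow> weight M (Poly_Mapping.single a 1) = a"
  by (simp add: weight_def lookup_single when_def if_distrib cong: if_cong)

text \<open>Each c_a is accompanied by v^(a-1) (1 + y)^(2a), so a monomial of degree n determines
  both the exponent of v and the power of 1 + y; \<open>q\<close> is the numerical factor left
  over.\<close>

lemma lookup_A_poly_power:
  "\<exists>q. Poly_Mapping.lookup (A_poly M ^ n) (i, \<mu>) = fls_const q * (1 + fls_X) ^ (2 * weight M \<mu>)
     \<and> (i \<noteq> int (weight M \<mu>) - int n \<longrightarrow> q = 0)"
proof (induction n arbitrary: i \<mu>)
  case 0
  show ?case
  proof (cases "(i, \<mu>) = 0")
    case True
    then show ?thesis by (intro exI[of _ 1]) (simp add: lookup_one zero_prod_def weight_def)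
  next
    case False
    then show ?thesis by (intro exI[of _ 0]) (simp add: lookup_one when_def)
  qed
next
  case (Suc n)
  \<comment> \<open>The claim for fixed i and \<mu> is stated as a predicate closed under addition,
    so that the summands of \<open>A_poly\<close> can be treated one at a time.\<close>
  define Q where "Q = (\<lambda>F :: rat fls. \<exists>q. F = fls_const q * (1 + fls_X) ^ (2 * weight M \<mu>)
     \<and> (i \<noteq> int (weight M \<mu>) - int (Suc n) \<longrightarrow> q = 0))"
  have Q_0: "Q 0" unfolding Q_def by (intro exI[of _ 0]) simp
  have Q_add: "Q (F + G)" if FG: "Q F" "Q G" for F G
  proof -
    obtain q r where "F = fls_const q * (1 + fls_X) ^ (2 * weight M \<mu>)" "i \<noteq> int (weight M \<mu>) - int (Suc n) \<longrightarrow> q = 0"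
      "G = fls_const r * (1 + fls_X) ^ (2 * weight M \<mu>)" "i \<noteq> int (weight M \<mu>) - int (Suc n) \<longrightarrow> r = 0"
      using FG unfolding Q_def by blast
    then show ?thesis unfolding Q_def
      by (intro exI[of _ "q + r"]) (simp add: fls_plus_const[symmetric] distrib_right)
  qed
  have Q_sum: "Q (\<Sum>a\<le>K. F a)" if "\<And>a. a \<le> K \<Longrightarrow> Q (F a)" for F and K :: nat
    using that by (induction K) (simp_all add: Q_add)
  have "Q (Poly_Mapping.lookup (Poly_Mapping.single (int a - 1, Poly_Mapping.single a 1) ((1 + fls_X) ^ (2 * a)) * A_poly M ^ n) (i, \<mu>))"
    if "a \<le> M" for a
  proof (cases "\<exists>m. (i, \<mu>) = (int a - 1, Poly_Mapping.single a 1) + m")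
    case False
    then show ?thesis by (subst lookup_single_mult_eq_0) (auto intro: Q_0)
  next
    case True
    then obtain j \<nu> where m: "(i, \<mu>) = (int a - 1, Poly_Mapping.single a 1) + (j, \<nu>)" by auto
    then have i: "i = int a - 1 + j" and \<mu>: "\<mu> = Poly_Mapping.single a 1 + \<nu>" by (simp_all add: plus_prod_def)
    have w: "weight M \<mu> = a + weight M \<nu>"
      using that by (simp add: \<mu> weight_add weight_single[unfolded One_nat_def])
    obtain q where q: "Poly_Mapping.lookup (A_poly M ^ n) (j, \<nu>) = fls_const q * (1 + fls_X) ^ (2 * weight M \<nu>)"
      "j \<noteq> int (weight M \<nu>) - int n \<longrightarrow> q = 0"
      using Suc.IH by blast
    show ?thesis unfolding m lookup_single_mult Q_def
      by (intro exI[of _ q]) (use q in \<open>auto simp: w i distrib_left power_add mult_ac\<close>)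
  qed
  then have "Q (Poly_Mapping.lookup (A_poly M * A_poly M ^ n) (i, \<mu>))"
    by (subst (1) A_poly_def) (simp add: sum_distrib_right lookup_sum Q_sum)
  then show ?case by (simp add: Q_def)
qed

lemma lookup_A_poly:
  assumes "N \<le> M"
  shows "Poly_Mapping.lookup (A_poly M) (int N - 1, \<mu>)
    = (if \<mu> = Poly_Mapping.single N 1 then (1 + fls_X) ^ (2 * N) else 0)"
proof -
  have "Poly_Mapping.lookup (A_poly M) (int N - 1, \<mu>)
    = (\<Sum>a\<le>M. if a = N then if \<mu> = Poly_Mapping.single N 1 then (1 + fls_X) ^ (2 * N) else 0 else 0)"
    unfolding A_poly_def lookup_sum
    by (intro sum.cong refl) (auto simp: lookup_single when_def)
  then show ?thesis using assms by simp
qed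

definition coeff_res :: "int \<Rightarrow> cmono \<Rightarrow> cpoly \<Rightarrow> rat" where
  "coeff_res i \<mu> x = Poly_Mapping.lookup x (i, \<mu>) $$ (- 2)"

lemma coeff_res_add: "coeff_res i \<mu> (x + y) = coeff_res i \<mu> x + coeff_res i \<mu> y"
  by (simp add: coeff_res_def lookup_add)

lemma coeff_res_sum: "coeff_res i \<mu> (sum f I) = (\<Sum>k\<in>I. coeff_res i \<mu> (f k))"
  by (induction I rule: infinite_finite_induct) (simp_all add: coeff_res_add, simp_all add: coeff_res_def)

text \<open>The coefficient of y^(-2) in (1/y) f' is the residue of f'.\<close>

lemma coeff_res_D: "coeff_res i \<mu> (D_coeff x) = 0"
  by (simp add: coeff_res_def lookup_D_coeff fls_X_inv_times_conv_shift)

lemma coeff_res_lagr: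
  assumes "n \<ge> 2"
  shows "coeff_res i \<mu> (coeff.lagr A H $ n) = 0"
proof -
  obtain m where "n = Suc (Suc m)" using assms by (metis add_2_eq_Suc le_Suc_ex)
  then have "coeff.lagr A H $ n = D_coeff (rat_coeff (1 / fact n) * (D_coeff ^^ m) (D_coeff H * A ^ n))"
    by (simp add: coeff.lagr_def coeff.D_sc)
  then show ?thesis by (simp only: coeff_res_D)
qed

text \<open>In degree \<open>Suc m\<close> every term of \<open>lagr_ext\<close> with k < m still
  carries an outer \<open>D\<close> and vanishes. The term k = \<open>Suc m\<close> gives the
  coefficient of \<open>h\<close>, and the term k = m gives its derivative after integration by
  parts.\<close>

lemma coeff_res_lagr_ext:
  "coeff_res i \<mu> (coeff.lagr_ext A (subst_ser A h) $ Suc m)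
    = coeff_res i \<mu> (A ^ Suc m * coeff_emb (h $ Suc m
        + fls_const (1 / of_nat (Suc m)) * (fls_X_inv * fls_deriv (h $ m))))"
proof -
  let ?r = "coeff_res i \<mu>"
  define c :: cpoly where "c = rat_coeff (1 / of_nat (Suc m))"
  define H where "H = coeff_emb (h $ m)"
  have "?r (coeff.lagr_ext A (subst_ser A h) $ Suc m)
    = (\<Sum>k\<le>Suc m. ?r (coeff.lagr A (subst_ser A h $ k) $ (Suc m - k)))"
    by (simp only: coeff.lagr_ext_def fps_nth_Abs_fps coeff_res_sum)
  also have "\<dots> = (\<Sum>k\<in>{m, Suc m}. ?r (coeff.lagr A (subst_ser A h $ k) $ (Suc m - k)))"
    by (rule sum.mono_neutral_right) (auto intro!: coeff_res_lagr)
  also have "\<dots> = ?r (D_coeff (H * A ^ m) * A) + ?r (coeff_emb (h $ Suc m) * A ^ Suc m)"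
    by (simp add: coeff.lagr_def subst_ser_nth coeff.sc_1 H_def)
  \<comment> \<open>Two integrations by parts: first the outer derivative is moved off
    \<open>H * A ^ m\<close>, then \<open>A ^ m * D_coeff A\<close> is written as the derivative of
    \<open>c * A ^ Suc m\<close>.\<close>
  also have "D_coeff (H * A ^ m) * A = D_coeff (H * A ^ Suc m + - (H * (c * A ^ Suc m))) + D_coeff H * (c * A ^ Suc m)"
  proof -
    have "c * D_coeff (A ^ Suc m) = (c * of_nat (Suc m)) * (A ^ m * D_coeff A)"
      unfolding coeff.D_power diff_Suc_1 by (simp only: mult.assoc)
    also have "c * of_nat (Suc m) = 1" unfolding c_def by (rule coeff.sc_inverse_cancel) simp
    finally have 1: "D_coeff (c * A ^ Suc m) = A ^ m * D_coeff A"
      unfolding c_def coeff.D_sc by simp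
    have 2: "D_coeff (H * A ^ Suc m) = D_coeff (H * A ^ m) * A + H * A ^ m * D_coeff A"
      unfolding power_Suc2 mult.assoc[symmetric] coeff.D_mult ..
    show ?thesis unfolding coeff.D_add coeff.D_minus 2 D_coeff_mult[of H "c * _"] 1
      by (simp add: algebra_simps)
  qed
  also have "?r \<dots> = ?r (D_coeff H * (c * A ^ Suc m))"
    by (simp only: coeff_res_add coeff_res_D add_0)
  also have "D_coeff H * (c * A ^ Suc m)
      = A ^ Suc m * coeff_emb (fls_const (1 / of_nat (Suc m)) * (fls_X_inv * fls_deriv (h $ m)))"
    by (simp only: H_def c_def D_coeff_emb rat_coeff_eq coeff_emb_mult mult_ac)
  finally show ?thesis
    by (simp only: coeff_emb_add distrib_left coeff_res_add mult.commute add.commute)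
qed

theorem theorem2:
  fixes N :: nat
  assumes "N \<ge> 1"
  shows "\<forall>\<mu> :: cmono.
    Poly_Mapping.lookup (ser_neg_pow_y (ser_scale (1/2) (ser_add T_ser (ser_const (lmono 1 0 1)))) N \<mu>)
           (int N - 1, -2)
    = Poly_Mapping.lookup (ser_scale (- (1/4) * of_nat N * of_nat ((2 * N + 2) choose (N + 1))) (cvar N) \<mu>)
           (0, 0)"
proof
  fix \<mu> :: cmono
  define G where "G = ser_neg_pow_y (ser_scale (1/2) (ser_add T_ser (ser_const (lmono 1 0 1)))) N"
  define c :: rat where "c = - (1/4) * of_nat N * of_nat ((2 * N + 2) choose (N + 1))"
  define h :: "rat fls fps" where "h = inv_pow_ser N"
  obtain M n where M: "N \<le> M" and \<mu>: "\<mu> \<in> monomials M n" by (rule ex_monomials)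
  have rhs: "Poly_Mapping.lookup (ser_scale c (cvar N) \<mu>) (0, 0) = (if \<mu> = Poly_Mapping.single N 1 then c else 0)"
    by (simp add: ser_scale_def cvar_def lmono_def)
  have n1: "n = 1" if "\<mu> = Poly_Mapping.single N 1"
    using \<mu> that by (simp add: single_in_monomials[unfolded One_nat_def])
  have lhs: "Poly_Mapping.lookup (G \<mu>) (int N - 1, - 2)
      = coeff_res (int N - 1) \<mu> (coeff.lagr_ext (A_poly M) (subst_ser (A_poly M) h) $ n)"
    unfolding h_def G_def graded_neg_pow[symmetric] coeff_res_def by (rule lookup_graded[OF \<mu>, symmetric])
  have "Poly_Mapping.lookup (G \<mu>) (int N - 1, - 2) = (if \<mu> = Poly_Mapping.single N 1 then c else 0)"
  proof (cases n)
    case 0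
    \<comment> \<open>In degree zero only v^0 y^(-N) occurs: the exponent of v forces N = 1, and
      then the exponent of y is -1 instead of -2.\<close>
    have "coeff_res (int N - 1) \<mu> (coeff_emb (fls_X_inv ^ N)) = 0"
      using assms by (auto simp: coeff_res_def coeff_emb_def lookup_single when_def zero_prod_def)
    then show ?thesis
      using n1 unfolding lhs 0 by (auto simp: coeff.lagr_ext_0 subst_ser_nth h_def inv_pow_ser_0)
  next
    case (Suc m)
    define F where "F = h $ n + fls_const (1 / of_nat n) * (fls_X_inv * fls_deriv (h $ m))"
    have lhs': "Poly_Mapping.lookup (G \<mu>) (int N - 1, - 2)
        = (Poly_Mapping.lookup (A_poly M ^ n) (int N - 1, \<mu>) * F) $$ (- 2)"
      unfolding lhs Suc coeff_res_lagr_ext F_def unfolding coeff_res_def lookup_mult_coeff_emb ..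
    show ?thesis
    proof (cases "n = 1")
      case True
      have "((1 + fls_X) ^ (2 * N) * F) $$ (- 2) = c"
        using coefficient_first_order[of N, where 'a = rat] Suc True by (simp add: F_def h_def c_def)
      then show ?thesis using True M unfolding lhs' by (simp add: lookup_A_poly[unfolded One_nat_def])
    next
      case False
      obtain q where q: "Poly_Mapping.lookup (A_poly M ^ n) (int N - 1, \<mu>) = fls_const q * (1 + fls_X) ^ (2 * weight M \<mu>)"
        "int N - 1 \<noteq> int (weight M \<mu>) - int n \<longrightarrow> q = 0"
        using lookup_A_poly_power by blast
      have "(Poly_Mapping.lookup (A_poly M ^ n) (int N - 1, \<mu>) * F) $$ (- 2) = 0"
      proof (cases "q = 0")
        case True
        then show ?thesis unfolding q(1) by simp
      next
        case False
        \<comment> \<open>A nonzero coefficient at v^(N-1) fixes the weight, hence the power of 1 +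
          y required by \<open>coefficient_higher_order\<close>.\<close>
        then have "weight M \<mu> = N + n - 1" using q(2) by auto
        moreover have "((1 + fls_X) ^ (2 * (N + n - 1)) * F) $$ (- 2) = 0"
          using coefficient_higher_order[of n N, where 'a = rat] \<open>n \<noteq> 1\<close> Suc assms
          by (simp add: F_def h_def)
        ultimately show ?thesis unfolding q(1) by (simp add: mult.assoc)
      qed
      then show ?thesis using n1 False unfolding lhs' by auto
    qed
  qed
  then show "Poly_Mapping.lookup (ser_neg_pow_y (ser_scale (1/2) (ser_add T_ser (ser_const (lmono 1 0 1)))) N \<mu>)
           (int N - 1, -2)
    = Poly_Mapping.lookup (ser_scale (- (1/4) * of_nat N * of_nat ((2 * N + 2) choose (N + 1))) (cvar N) \<mu>)
           (0, 0)"
    unfolding G_def c_def[symmetric] rhs .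
qed

end
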